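(* Let $\mathbb H^n$ be the Heisenberg group endowed with a rotationally invariant homogeneous distance, let $1\le m\le n$, and let $\mathfrak d:\mathscr T_{\mathbb H^n,\mathbb R^m}\to(0,+\infty)$ be the density function associated with the measure $\psi^{2n+2-m}$, i.e. the function such that $$\lim_{r\to0^+}\frac{\psi^{2n+2-m}(\Sigma\cap B(p,r))}{r^{2n+2-m}}=\mathfrak d(T^H_p\Sigma)$$ for every $C^1_H(\mathbb H^n;\mathbb R^m)$-submanifold $\Sigma$ and every $p\in\Sigma$. If $\psi^{2n+2-m}=\mathcal S^{2n+2-m}$ is the spherical Hausdorff measure, then $\mathfrak d$ is constant. If $m=1$ and $\psi^{2n+2-m}=\mathcal H^{2n+1}$ is the Hausdorff measure, then $\mathfrak d$ is constant.
   Context: Heisenberg group $\mathbb H^n$ ($n\ge1$): $\mathbb R^n\times\mathbb R^n\times\mathbb R\ni(x,y,t)$ with product $(x,y,t)(x',y',t')=(x+x',y+y',t+t'+\frac12\sum_j(x_jy_j'-x_j'y_j))$; dilations $\delta_\lambda(x,y,t)=(\lambda x,\lambda y,\lambda^2t)$, $\lambda>0$. A homogeneous distance is a left-invariant distance $\rho$ with $\rho(\delta_\lambda p,\delta_\lambda q)=\lambda\rho(p,q)$; it is rotationally invariant if $\rho(0,(x,y,t))=\rho(0,(x',y',t))$ whenever $|(x,y)|=|(x',y')|$ (Euclidean norm of $\mathbb R^{2n}$). $B(p,r)$ is the open ball. A homogeneous subgroup is a subgroup invariant under all $\delta_\lambda$; a homogeneous morphism is a group morphism commuting with dilations ($\mathbb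 R^m$ has dilations $v\mapsto\lambda v$). Homogeneous subgroups $\mathbb W,\mathbb V$ are complementary if $\mathbb H^n=\mathbb W\mathbb V$ and $\mathbb W\cap\mathbb V=\{0\}$; a normal homogeneous subgroup splits $\mathbb H^n$ if it has a complementary homogeneous subgroup. $\mathscr T_{\mathbb H^n,\mathbb R^m}$ is the set of normal subgroups of $\mathbb H^n$ that have a complementary subgroup and are kernels of surjective homogeneous morphisms $\mathbb H^n\to\mathbb R^m$. Measures (no normalization constants): $\mathcal H^d(E)=\lim_{\epsilon\to0^+}\inf\{\sum_j(\operatorname{diam}E_j)^d: E\subset\bigcup_jE_j,\ \operatorname{diam}E_j<\epsilon\}$ and $\mathcal S^d(E)=\lim_{\epsilon\to0^+}\inf\{\sum_j(2r_j)^d: E\subset\bigcup_j\overline B(x_j,r_j),\ 2r_j<\epsilon\}$, $\overline B$ closed balls. $\psi^d$ denotes either $\mathcal H^d$ or $\mathcal S^d$. For $U\subset\mathbb H^n$ open, $f:U\to\mathbb R^m$ is Pansu differentiable at $p$ if there is a homogeneous morphism $L=D_Hf_p$ with $\lim_{x\to p}|f(x)-f(p)-L(p^{-1}x)|/\rho(p,x)=0$; $f\in C^1_H(U;\mathbb R^m)$ if this holds at all $p\in U$ and $p\mapsto D_Hf_p$ is continuous. $p$ is split-regular for $f$ if $D_Hf_p$ is surjective and $\ker D_Hf_p$ splits $\mathbb H^n$. $\Sigma$ is a $C^1_H(\mathbb H^n;\mathbb R^m)$-submanifold if every $p\in\Sigma$ has an open neighborhood $U$ and $f\in C^1_H(U;\mathbb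 R^m)$ with $p$ split-regular for $f$ and $\Sigma\cap U=\{f=0\}$; then $T^H_p\Sigma:=\ker D_Hf_p$ (independent of $f$). The function $\mathfrak d$ exists and is uniquely determined by the displayed property (every $\mathbb P\in\mathscr T_{\mathbb H^n,\mathbb R^m}$ is itself such a submanifold, with $T^H_0\mathbb P=\mathbb P$). *)

theory Defs
  imports "HOL-Analysis.Analysis" "HOL-Algebra.Coset"
begin

type_synonym 'n heis = "(real^'n) \<times> (real^'n) \<times> real"

definition heis_mult :: "'n::finite heis \<Rightarrow> 'n heis \<Rightarrow> 'n heis" where
  "heis_mult p q =
     (case (p, q) of ((x, y, t), (x', y', t')) \<Rightarrow>
        (x + x', y + y', t + t' + (1/2) * (\<Sum>j\<in>UNIV. x $ j * y' $ j - x' $ j * y $ j)))"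

definition heis_group :: "'n::finite heis monoid" where
  "heis_group = \<lparr>carrier = UNIV, mult = heis_mult, one = 0\<rparr>"

definition vec_group :: "(real^'m::finite) monoid" where
  "vec_group = \<lparr>carrier = UNIV, mult = (+), one = 0\<rparr>"

definition dil :: "real \<Rightarrow> 'n::finite heis \<Rightarrow> 'n heis" where
  "dil c p = (case p of (x, y, t) \<Rightarrow> (c *\<^sub>R x, c *\<^sub>R y, c\<^sup>2 * t))"

definition homogeneous_subgroup :: "'n::finite heis set \<Rightarrow> bool" where
  "homogeneous_subgroup W \<longleftrightarrow>
     subgroup W heis_group \<and> (\<forall>c>0. \<forall>p\<in>W. dil c p \<in> W)"

definition complementary :: "'n::finite heis set \<Rightarrow> 'n heis set \<Rightarrow> bool" where
  "complementary W V \<longleftrightarrow>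
     homogeneous_subgroup W \<and> homogeneous_subgroup V \<and>
     W <#>\<^bsub>heis_group\<^esub> V = UNIV \<and> W \<inter> V = {\<one>\<^bsub>heis_group\<^esub>}"

definition homogeneous_morphism :: "('n::finite heis \<Rightarrow> real^'m::finite) \<Rightarrow> bool" where
  "homogeneous_morphism L \<longleftrightarrow>
     L \<in> hom heis_group vec_group \<and> (\<forall>c>0. \<forall>p. L (dil c p) = c *\<^sub>R L p)"

text \<open>The set \<open>\<T>\<close> of kernels; the dimension \<open>m\<close> of the target \<open>\<real>\<^sup>m\<close> is passed as a type.\<close>

definition tangent_subgroups :: "'m::finite itself \<Rightarrow> 'n::finite heis set set" where
  "tangent_subgroups (_ :: 'm itself) =
     {P. P \<lhd> heis_group \<and> (\<exists>V. complementary P V) \<and>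
         (\<exists>L :: 'n heis \<Rightarrow> real^'m. homogeneous_morphism L \<and> surj L \<and>
            P = kernel heis_group vec_group L)}"

definition homogeneous_distance :: "('n::finite heis \<Rightarrow> 'n heis \<Rightarrow> real) \<Rightarrow> bool" where
  "homogeneous_distance \<rho> \<longleftrightarrow>
     Metric_space UNIV \<rho> \<and>
     (\<forall>g p q. \<rho> (g \<otimes>\<^bsub>heis_group\<^esub> p) (g \<otimes>\<^bsub>heis_group\<^esub> q) = \<rho> p q) \<and>
     (\<forall>c>0. \<forall>p q. \<rho> (dil c p) (dil c q) = c * \<rho> p q)"

text \<open>The norm of the pair \<open>(x, y)\<close> is the Euclidean norm of \<open>\<real>\<^sup>2\<^sup>n\<close>.\<close>

definition rotationally_invariant :: "('n::finite heis \<Rightarrow> 'n heis \<Rightarrow> real) \<Rightarrow> bool" where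
  "rotationally_invariant \<rho> \<longleftrightarrow>
     (\<forall>x y x' y' t. norm (x, y) = norm (x', y') \<longrightarrow> \<rho> 0 (x, y, t) = \<rho> 0 (x', y', t))"

text \<open>Infinite for unbounded sets, \<open>0\<close> for the empty set; finite covers are therefore included
  among the sequences below.\<close>

definition diam :: "('a \<Rightarrow> 'a \<Rightarrow> real) \<Rightarrow> 'a set \<Rightarrow> ennreal" where
  "diam \<rho> E = (SUP (p, q)\<in>E \<times> E. ennreal (\<rho> p q))"

definition hausdorff_premeasure ::
    "('a \<Rightarrow> 'a \<Rightarrow> real) \<Rightarrow> nat \<Rightarrow> real \<Rightarrow> 'a set \<Rightarrow> ennreal" where
  "hausdorff_premeasure \<rho> d \<epsilon> E =
     Inf {\<Sum>j. diam \<rho> (F j) ^ d | F :: nat \<Rightarrow> 'a set.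
            E \<subseteq> (\<Union>j. F j) \<and> (\<forall>j. diam \<rho> (F j) < ennreal \<epsilon>)}"

definition hausdorff_measure :: "('a \<Rightarrow> 'a \<Rightarrow> real) \<Rightarrow> nat \<Rightarrow> 'a set \<Rightarrow> ennreal" where
  "hausdorff_measure \<rho> d E = Lim (at_right 0) (\<lambda>\<epsilon>. hausdorff_premeasure \<rho> d \<epsilon> E)"

definition spherical_premeasure ::
    "('a \<Rightarrow> 'a \<Rightarrow> real) \<Rightarrow> nat \<Rightarrow> real \<Rightarrow> 'a set \<Rightarrow> ennreal" where
  "spherical_premeasure \<rho> d \<epsilon> E =
     Inf {\<Sum>j. ennreal ((2 * r j) ^ d) | (x :: nat \<Rightarrow> 'a) (r :: nat \<Rightarrow> real).
            E \<subseteq> (\<Union>j. Metric_space.mcball UNIV \<rho> (x j) (r j)) \<and>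
            (\<forall>j. 0 < r j \<and> 2 * r j < \<epsilon>)}"

definition spherical_measure :: "('a \<Rightarrow> 'a \<Rightarrow> real) \<Rightarrow> nat \<Rightarrow> 'a set \<Rightarrow> ennreal" where
  "spherical_measure \<rho> d E = Lim (at_right 0) (\<lambda>\<epsilon>. spherical_premeasure \<rho> d \<epsilon> E)"

text \<open>Open sets and limits on the Heisenberg group refer to the Euclidean topology of
  \<open>\<real>\<^sup>2\<^sup>n\<^sup>+\<^sup>1\<close>, which is also the topology of every homogeneous distance.\<close>

definition has_pansu_derivative ::
    "('n::finite heis \<Rightarrow> 'n heis \<Rightarrow> real) \<Rightarrow> ('n heis \<Rightarrow> real^'m::finite) \<Rightarrow> 'n heis \<Rightarrow>
     ('n heis \<Rightarrow> real^'m) \<Rightarrow> bool" where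
  "has_pansu_derivative \<rho> f p L \<longleftrightarrow>
     homogeneous_morphism L \<and>
     ((\<lambda>x. norm (f x - f p - L (inv\<^bsub>heis_group\<^esub> p \<otimes>\<^bsub>heis_group\<^esub> x)) / \<rho> p x) \<longlongrightarrow> 0) (at p)"

definition pansu_derivative ::
    "('n::finite heis \<Rightarrow> 'n heis \<Rightarrow> real) \<Rightarrow> ('n heis \<Rightarrow> real^'m::finite) \<Rightarrow> 'n heis \<Rightarrow>
     ('n heis \<Rightarrow> real^'m)" where
  "pansu_derivative \<rho> f p = (THE L. has_pansu_derivative \<rho> f p L)"

text \<open>Functions on an open set \<open>U\<close> are represented by total functions whose values off \<open>U\<close> are
  irrelevant. Continuity of the derivative is with respect to the topology of pointwise convergence,
  which on the finite-dimensional space of homogeneous morphisms is its usual topology.\<close>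

definition C1H ::
    "('n::finite heis \<Rightarrow> 'n heis \<Rightarrow> real) \<Rightarrow> 'n heis set \<Rightarrow> ('n heis \<Rightarrow> real^'m::finite) \<Rightarrow> bool" where
  "C1H \<rho> U f \<longleftrightarrow>
     (\<forall>p\<in>U. \<exists>L. has_pansu_derivative \<rho> f p L) \<and> continuous_on U (pansu_derivative \<rho> f)"

definition split_regular ::
    "('n::finite heis \<Rightarrow> 'n heis \<Rightarrow> real) \<Rightarrow> ('n heis \<Rightarrow> real^'m::finite) \<Rightarrow> 'n heis \<Rightarrow> bool" where
  "split_regular \<rho> f p \<longleftrightarrow>
     surj (pansu_derivative \<rho> f p) \<and>
     (\<exists>V. complementary (kernel heis_group vec_group (pansu_derivative \<rho> f p)) V)"

definition local_equation ::
    "('n::finite heis \<Rightarrow> 'n heis \<Rightarrow> real) \<Rightarrow> 'n heis set \<Rightarrow> 'n heis \<Rightarrow> 'n heis set \<Rightarrow>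
     ('n heis \<Rightarrow> real^'m::finite) \<Rightarrow> bool" where
  "local_equation \<rho> \<Sigma> p U f \<longleftrightarrow>
     open U \<and> p \<in> U \<and> C1H \<rho> U f \<and> split_regular \<rho> f p \<and> \<Sigma> \<inter> U = {q\<in>U. f q = 0}"

definition C1H_submanifold ::
    "'m::finite itself \<Rightarrow> ('n::finite heis \<Rightarrow> 'n heis \<Rightarrow> real) \<Rightarrow> 'n heis set \<Rightarrow> bool" where
  "C1H_submanifold (_ :: 'm itself) \<rho> \<Sigma> \<longleftrightarrow>
     (\<forall>p\<in>\<Sigma>. \<exists>U (f :: 'n heis \<Rightarrow> real^'m). local_equation \<rho> \<Sigma> p U f)"

text \<open>The description is unambiguous because the kernel does not depend on the local equation.\<close>

definition horizontal_tangent ::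
    "'m::finite itself \<Rightarrow> ('n::finite heis \<Rightarrow> 'n heis \<Rightarrow> real) \<Rightarrow> 'n heis set \<Rightarrow> 'n heis \<Rightarrow>
     'n heis set" where
  "horizontal_tangent (_ :: 'm itself) \<rho> \<Sigma> p =
     (THE P. \<exists>U (f :: 'n heis \<Rightarrow> real^'m). local_equation \<rho> \<Sigma> p U f \<and>
        P = kernel heis_group vec_group (pansu_derivative \<rho> f p))"

definition is_density_function ::
    "'m::finite itself \<Rightarrow> ('n::finite heis \<Rightarrow> 'n heis \<Rightarrow> real) \<Rightarrow> ('n heis set \<Rightarrow> ennreal) \<Rightarrow>
     ('n heis set \<Rightarrow> real) \<Rightarrow> bool" where
  "is_density_function (_ :: 'm itself) \<rho> \<psi> \<dd> \<longleftrightarrow>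
     (\<forall>P \<in> tangent_subgroups TYPE('m). 0 < \<dd> P) \<and>
     (\<forall>\<Sigma>. C1H_submanifold TYPE('m) \<rho> \<Sigma> \<longrightarrow>
        (\<forall>p\<in>\<Sigma>.
           ((\<lambda>r. \<psi> (\<Sigma> \<inter> Metric_space.mball UNIV \<rho> p r)
                   / ennreal (r ^ (2 * CARD('n) + 2 - CARD('m))))
             \<longlongrightarrow> ennreal (\<dd> (horizontal_tangent TYPE('m) \<rho> \<Sigma> p))) (at_right 0)))"

lemma heis_mult_assoc: "heis_mult (heis_mult p q) r = heis_mult p (heis_mult q r)"
  by (auto simp: heis_mult_def split: prod.splits)
     (simp add: field_simps sum.distrib sum_subtractf)

lemma group_heis_group: "group heis_group"
proof (rule groupI)
  fix p :: "'n::finite heis"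
  obtain x y t where p: "p = (x, y, t)" by (cases p) auto
  have "heis_mult (- x, - y, - t) p = 0"
    by (simp add: p heis_mult_def zero_prod_def mult.commute)
  then show "\<exists>q\<in>carrier heis_group. q \<otimes>\<^bsub>heis_group\<^esub> p = \<one>\<^bsub>heis_group\<^esub>"
    by (auto simp: heis_group_def)
qed (auto simp: heis_group_def heis_mult_assoc, auto simp: heis_mult_def zero_prod_def)

lemma group_vec_group: "group vec_group"
proof (rule groupI)
  fix v :: "real^'m::finite"
  have "- v \<in> carrier vec_group" "- v \<otimes>\<^bsub>vec_group\<^esub> v = \<one>\<^bsub>vec_group\<^esub>"
    by (simp_all add: vec_group_def)
  then show "\<exists>w\<in>carrier vec_group. w \<otimes>\<^bsub>vec_group\<^esub> v = \<one>\<^bsub>vec_group\<^esub>" by blast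
qed (simp_all add: vec_group_def add.assoc)

lemma Lim_at_right_0_antimono:
  fixes g :: "real \<Rightarrow> ennreal"
  assumes "\<And>a b. 0 < a \<Longrightarrow> a \<le> b \<Longrightarrow> g b \<le> g a"
  shows "Lim (at_right 0) g = (SUP \<epsilon>\<in>{0<..}. g \<epsilon>)"
proof (rule tendsto_Lim)
  show "(g \<longlongrightarrow> (SUP \<epsilon>\<in>{0<..}. g \<epsilon>)) (at_right 0)"
  proof (rule order_tendstoI)
    fix a assume "a < (SUP \<epsilon>\<in>{0<..}. g \<epsilon>)"
    then obtain e where e: "e > 0" "a < g e" by (auto simp: less_SUP_iff)
    have "eventually (\<lambda>x. x \<in> {0<..<e}) (at_right 0)"
      using e(1) by (rule eventually_at_right_real)
    then show "eventually (\<lambda>x. a < g x) (at_right 0)"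
    proof eventually_elim
      case (elim x)
      then have "g e \<le> g x" by (intro assms) auto
      with e(2) show ?case by (rule less_le_trans)
    qed
  next
    fix a assume a: "(SUP \<epsilon>\<in>{0<..}. g \<epsilon>) < a"
    have "eventually (\<lambda>x. x \<in> {0<..<1::real}) (at_right 0)"
      by (rule eventually_at_right_real) simp
    then show "eventually (\<lambda>x. g x < a) (at_right 0)"
    proof eventually_elim
      case (elim x)
      then have "g x \<le> (SUP \<epsilon>\<in>{0<..}. g \<epsilon>)" by (intro SUP_upper) auto
      with a show ?case by (rule order.strict_trans1[rotated])
    qed
  qed
qed simp

lemma hausdorff_measure_eq_SUP:
  "hausdorff_measure \<rho> d E = (SUP \<epsilon>\<in>{0<..}. hausdorff_premeasure \<rho> d \<epsilon> E)"
  unfolding hausdorff_measure_def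
proof (rule Lim_at_right_0_antimono)
  fix a b :: real assume "0 < a" "a \<le> b"
  then have "ennreal a \<le> ennreal b" by (simp add: ennreal_leI)
  then show "hausdorff_premeasure \<rho> d b E \<le> hausdorff_premeasure \<rho> d a E"
    unfolding hausdorff_premeasure_def
    by (intro Inf_superset_mono) (blast intro: less_le_trans)
qed

lemma spherical_measure_eq_SUP:
  "spherical_measure \<rho> d E = (SUP \<epsilon>\<in>{0<..}. spherical_premeasure \<rho> d \<epsilon> E)"
  unfolding spherical_measure_def
proof (rule Lim_at_right_0_antimono)
  fix a b :: real assume "0 < a" "a \<le> b"
  then show "spherical_premeasure \<rho> d b E \<le> spherical_premeasure \<rho> d a E"
    unfolding spherical_premeasure_def
    by (intro Inf_superset_mono) (blast intro: less_le_trans)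
qed

lemma has_pansu_derivative_unique:
  fixes \<rho> :: "'n::finite heis \<Rightarrow> 'n heis \<Rightarrow> real" and f :: "'n heis \<Rightarrow> real^'m::finite"
  assumes \<rho>: "homogeneous_distance \<rho>"
    and L: "has_pansu_derivative \<rho> f p L" and M: "has_pansu_derivative \<rho> f p M"
  shows "L = M"
proof
  interpret G: group "heis_group :: 'n heis monoid" by (rule group_heis_group)
  interpret Metric_space UNIV \<rho> using \<rho> by (simp add: homogeneous_distance_def)
  fix q :: "'n heis"
  have car: "u \<in> carrier heis_group" for u :: "'n heis" by (simp add: heis_group_def)
  have one: "\<one>\<^bsub>heis_group\<^esub> = (0 :: 'n heis)" by (simp add: heis_group_def)
  have hom1: "N 0 = 0" if "has_pansu_derivative \<rho> f p N" for N
  proof -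
    have "N \<in> hom heis_group vec_group"
      using that by (simp add: has_pansu_derivative_def homogeneous_morphism_def)
    from hom_one[OF this group_heis_group group_vec_group] show ?thesis
      by (simp add: heis_group_def vec_group_def)
  qed
  show "L q = M q"
  proof (cases "q = 0")
    case True
    with hom1[OF L] hom1[OF M] show ?thesis by simp
  next
    case False
    define x where "x s = p \<otimes>\<^bsub>heis_group\<^esub> dil s q" for s
    have dil0: "dil s (0 :: 'n heis) = 0" for s by (simp add: dil_def zero_prod_def)
    have pos: "\<rho> 0 q > 0" using False mdist_pos_less[of 0 q] by simp
    have \<rho>x: "\<rho> p (x s) = s * \<rho> 0 q" if "s > 0" for s
    proof -
      have "\<rho> p (x s) = \<rho> (p \<otimes>\<^bsub>heis_group\<^esub> 0) (p \<otimes>\<^bsub>heis_group\<^esub> dil s q)"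
        using G.r_one[of p] car[of p] by (simp add: one x_def)
      also have "\<dots> = \<rho> (dil s 0) (dil s q)"
        unfolding dil0 using \<rho> unfolding homogeneous_distance_def by blast
      also have "\<dots> = s * \<rho> 0 q" using \<rho> that unfolding homogeneous_distance_def by blast
      finally show ?thesis .
    qed
    have px: "inv\<^bsub>heis_group\<^esub> p \<otimes>\<^bsub>heis_group\<^esub> x s = dil s q" for s
      unfolding x_def using G.m_assoc[of "inv\<^bsub>heis_group\<^esub> p" p "dil s q"] car
      by (simp add: G.l_inv)
    have xp: "filterlim x (at p) (at_right 0)"
    proof (rule filterlim_atI)
      obtain a b c where q: "q = (a, b, c)" by (cases q) auto
      obtain a' b' c' where p': "p = (a', b', c')" by (cases p) auto
      have x_eq: "x s = (a' + s *\<^sub>R a, b' + s *\<^sub>R b, c' + s\<^sup>2 * c +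
          (1/2) * (\<Sum>j\<in>UNIV. a' $ j * (s *\<^sub>R b) $ j - (s *\<^sub>R a) $ j * b' $ j))" for s
        by (simp add: x_def q p' heis_group_def heis_mult_def dil_def)
      have "(x \<longlongrightarrow> (a' + 0 *\<^sub>R a, b' + 0 *\<^sub>R b, c' + 0\<^sup>2 * c +
          (1/2) * (\<Sum>j\<in>UNIV. a' $ j * (0 *\<^sub>R b) $ j - (0 *\<^sub>R a) $ j * b' $ j))) (at_right 0)"
        unfolding x_eq[abs_def] by (intro tendsto_intros)
      then show "(x \<longlongrightarrow> p) (at_right 0)" by (simp add: p')
      have "x s \<noteq> p" if "s > 0" for s
        using \<rho>x[OF that] pos that mdist_zero[of p] by auto
      then show "\<forall>\<^sub>F s in at_right 0. x s \<noteq> p"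
        by (auto simp: eventually_at_filter)
    qed
    have lim: "((\<lambda>s. norm (f (x s) - f p - N (dil s q)) / \<rho> p (x s)) \<longlongrightarrow> 0) (at_right 0)"
      if "has_pansu_derivative \<rho> f p N" for N
    proof -
      have "((\<lambda>y. norm (f y - f p - N (inv\<^bsub>heis_group\<^esub> p \<otimes>\<^bsub>heis_group\<^esub> y)) / \<rho> p y) \<longlongrightarrow> 0) (at p)"
        using that by (simp add: has_pansu_derivative_def)
      from filterlim_compose[OF this xp] show ?thesis by (simp add: px)
    qed
    have sum: "((\<lambda>s. norm (f (x s) - f p - L (dil s q)) / \<rho> p (x s) +
        norm (f (x s) - f p - M (dil s q)) / \<rho> p (x s)) \<longlongrightarrow> 0 + 0) (at_right 0)"
      by (intro tendsto_add lim L M)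
    have le: "norm (L q - M q) / \<rho> 0 q \<le> norm (f (x s) - f p - L (dil s q)) / \<rho> p (x s) +
        norm (f (x s) - f p - M (dil s q)) / \<rho> p (x s)" if s: "s > 0" for s
    proof -
      have "L (dil s q) = s *\<^sub>R L q" "M (dil s q) = s *\<^sub>R M q"
        using L M s unfolding has_pansu_derivative_def homogeneous_morphism_def by blast+
      then have "s * norm (L q - M q) = norm (L (dil s q) - M (dil s q))"
        using s by (simp flip: scaleR_diff_right)
      also have "\<dots> \<le> norm (f (x s) - f p - L (dil s q)) + norm (f (x s) - f p - M (dil s q))"
        using norm_triangle_ineq4[of "f (x s) - f p - M (dil s q)" "f (x s) - f p - L (dil s q)"]
        by (simp add: algebra_simps)
      finally have "s * norm (L q - M q) / (s * \<rho> 0 q) \<le>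
          (norm (f (x s) - f p - L (dil s q)) + norm (f (x s) - f p - M (dil s q))) / (s * \<rho> 0 q)"
        using s pos by (intro divide_right_mono) auto
      then show ?thesis using s by (simp add: \<rho>x add_divide_distrib)
    qed
    have "norm (L q - M q) / \<rho> 0 q \<le> 0 + 0"
      by (rule tendsto_lowerbound[OF sum])
         (auto simp: eventually_at_filter intro!: always_eventually le)
    then have "norm (L q - M q) \<le> 0" using pos by (simp add: divide_le_0_iff)
    then show ?thesis by simp
  qed
qed

lemma pansu_derivative_eq:
  "homogeneous_distance \<rho> \<Longrightarrow> has_pansu_derivative \<rho> f p L \<Longrightarrow> pansu_derivative \<rho> f p = L"
  unfolding pansu_derivative_def by (blast intro: has_pansu_derivative_unique)

end

theory Submission
  imports Defs
begin

text \<open>Every \<open>P\<close> in the set of tangent subgroups is of the form \<open>W \<times> \<real>\<close> with a linear subspace \<open>W\<close> of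
  \<open>\<real>\<^sup>2\<^sup>n\<close> of dimension \<open>k = 2n - m\<close>, and it is its own tangent subgroup at \<open>0\<close>, so \<open>\<dd> P\<close> is read off from
  \<open>\<psi> (P \<inter> B(0,r))\<close>. For \<open>m = 1\<close> any two hyperplanes \<open>W\<close> are exchanged by a unitary map of \<open>\<complex>\<^sup>n\<close>, and
  unitary maps induce isometries of a rotationally invariant distance.

  For the spherical measure and \<open>d = k + 2\<close>, let \<open>\<mu>\<close> be the Lebesgue (Haar) measure of \<open>P\<close>. A Vitali
  covering argument shows \<open>\<S>\<^sup>d = 2\<^sup>d \<mu> / sup\<^sub>q \<mu>(closed B(q,1))\<close> on relatively open subsets of \<open>P\<close>, where \<open>q\<close>
  ranges over the whole Heisenberg group. Write the horizontal part of \<open>q\<close> as \<open>a + v\<close> with \<open>a \<in> W\<close> and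
  \<open>v \<bottom> W\<close>. The fibre of the ball \<open>B(q,1)\<close> over \<open>w \<in> W\<close> is a vertical translate of the fibre of \<open>B(0,1)\<close>
  over \<open>w - a - v\<close>, whose length depends only on \<open>|w - a|\<^sup>2 + |v|\<^sup>2\<close>. Hence \<open>\<mu>(B(q,1))\<close> depends on \<open>k\<close> and
  \<open>|v|\<close> only, although the groups \<open>P\<close> for different \<open>W\<close> need not be isomorphic.\<close>

section \<open>The Heisenberg group and its homogeneous distances\<close>

lemma heis_mult_Pair:
  "heis_mult (x, y, t) (x', y', t') = (x + x', y + y', t + t' + (x \<bullet> y' - x' \<bullet> y) / 2)"
  by (simp add: heis_mult_def inner_vec_def sum_subtractf)

lemma heis_mult_0 [simp]: "heis_mult 0 p = p" "heis_mult p 0 = p"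
  by (cases p; simp add: zero_prod_def heis_mult_Pair)+

lemma heis_mult_uminus [simp]: "heis_mult (- p) p = 0" "heis_mult p (- p) = 0"
  by (cases p; simp add: zero_prod_def heis_mult_Pair inner_commute)+

lemma heis_mult_uminus_cancel [simp]:
  "heis_mult (- p) (heis_mult p q) = q" "heis_mult p (heis_mult (- p) q) = q"
  by (simp_all flip: heis_mult_assoc)

lemma mult_heis_group [simp]: "p \<otimes>\<^bsub>heis_group\<^esub> q = heis_mult p q"
  and one_heis_group [simp]: "\<one>\<^bsub>heis_group\<^esub> = 0"
  and carrier_heis_group [simp]: "carrier heis_group = UNIV"
  by (simp_all add: heis_group_def)

lemma inv_heis_group [simp]: "inv\<^bsub>heis_group\<^esub> p = - p"
  using group.inv_equality[OF group_heis_group, of "- p" p] by simp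

lemma dil_Pair: "dil c (x, y, t) = (c *\<^sub>R x, c *\<^sub>R y, c\<^sup>2 * t)"
  by (simp add: dil_def)

lemma dil_dil: "dil a (dil b p) = dil (a * b) p"
  by (cases p) (simp add: dil_Pair power_mult_distrib)

lemma dil_1 [simp]: "dil 1 p = p"
  by (cases p) (simp add: dil_Pair)

lemma dil_0_right [simp]: "dil c 0 = 0"
  by (simp add: zero_prod_def dil_Pair)

lemma dil_inverse_cancel [simp]:
  "c \<noteq> 0 \<Longrightarrow> dil c (dil (1 / c) p) = p" "c \<noteq> 0 \<Longrightarrow> dil (1 / c) (dil c p) = p"
  by (simp_all add: dil_dil)

lemma continuous_on_heis_mult [continuous_intros]:
  fixes f g :: "'a::topological_space \<Rightarrow> 'n::finite heis"
  assumes "continuous_on S f" "continuous_on S g"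
  shows "continuous_on S (\<lambda>x. heis_mult (f x) (g x))"
proof -
  have "(\<lambda>x. heis_mult (f x) (g x)) = (\<lambda>x. (fst (f x) + fst (g x),
      fst (snd (f x)) + fst (snd (g x)), snd (snd (f x)) + snd (snd (g x)) +
      (fst (f x) \<bullet> fst (snd (g x)) - fst (g x) \<bullet> fst (snd (f x))) / 2))"
    (is "_ = ?h") by (rule ext) (metis heis_mult_Pair prod.collapse)
  moreover have "continuous_on S ?h" by (intro continuous_intros assms) simp
  ultimately show ?thesis by (simp only:)
qed

lemma continuous_on_dil [continuous_intros]:
  fixes f :: "'a::topological_space \<Rightarrow> 'n::finite heis"
  assumes "continuous_on S f"
  shows "continuous_on S (\<lambda>x. dil c (f x))"
proof -
  have "(\<lambda>x. dil c (f x)) =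
      (\<lambda>x. (c *\<^sub>R fst (f x), c *\<^sub>R fst (snd (f x)), c\<^sup>2 * snd (snd (f x))))"
    (is "_ = ?h") by (rule ext) (metis dil_Pair prod.collapse)
  moreover have "continuous_on S ?h" by (intro continuous_intros assms)
  ultimately show ?thesis by (simp only:)
qed

text \<open>Preimages under the inverse map give Borel measurability of translates directly, and
  \<open>image_dil\<close> does the same for dilates.\<close>

lemma image_heis_mult: "heis_mult p ` E = heis_mult (- p) -` E"
  by (auto intro: image_eqI[of _ _ "heis_mult (- p) _"])

lemma image_dil: "c \<noteq> 0 \<Longrightarrow> dil c ` E = dil (1 / c) -` E"
  by (auto intro: image_eqI[of _ _ "dil (1 / c) _"])

lemma borel_measurable_heis_mult [measurable]: "heis_mult p \<in> borel_measurable borel"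
  by (intro borel_measurable_continuous_onI continuous_intros)

lemma borel_measurable_dil [measurable]: "dil c \<in> borel_measurable borel"
  by (intro borel_measurable_continuous_onI continuous_intros)

section \<open>Homogeneous and rotationally invariant distances\<close>

locale homogeneous_metric =
  fixes \<rho> :: "'n::finite heis \<Rightarrow> 'n heis \<Rightarrow> real"
  assumes homogeneous: "homogeneous_distance \<rho>"
begin

sublocale Metric_space UNIV \<rho>
  using homogeneous unfolding homogeneous_distance_def by (simp del: split_paired_All)

lemma dist_mult [simp]: "\<rho> (heis_mult g p) (heis_mult g q) = \<rho> p q"
  using homogeneous unfolding homogeneous_distance_def by (simp del: split_paired_All)

lemma dist_dil: "c > 0 \<Longrightarrow> \<rho> (dil c p) (dil c q) = c * \<rho> p q"
  using homogeneous unfolding homogeneous_distance_def by (simp del: split_paired_All)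

lemma dist_eq: "\<rho> p q = \<rho> 0 (heis_mult (- p) q)"
  using dist_mult[of "- p" p q] by simp

lemma dist_0_dil: "c > 0 \<Longrightarrow> \<rho> 0 (dil c p) = c * \<rho> 0 p"
  using dist_dil[of c 0 p] by simp

lemma dist_0_mult_le: "\<rho> 0 (heis_mult p q) \<le> \<rho> 0 p + \<rho> 0 q"
  using triangle[of 0 p "heis_mult p q"] dist_mult[of p 0 q] by simp

lemma mball_image: "r > 0 \<Longrightarrow> heis_mult w ` dil r ` mball q s = mball (heis_mult w (dil r q)) (r * s)"
proof -
  assume r: "r > 0"
  have "\<rho> (heis_mult w (dil r q)) p = r * \<rho> q (dil (1/r) (heis_mult (- w) p))" for p
    using dist_mult[of "- w" "heis_mult w (dil r q)" p]
      dist_dil[OF r, of q "dil (1/r) (heis_mult (- w) p)"] r by simp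
  with r show ?thesis by (auto simp: image_heis_mult image_dil)
qed

lemma mcball_image: "r > 0 \<Longrightarrow> heis_mult w ` dil r ` mcball q s = mcball (heis_mult w (dil r q)) (r * s)"
proof -
  assume r: "r > 0"
  have "\<rho> (heis_mult w (dil r q)) p = r * \<rho> q (dil (1/r) (heis_mult (- w) p))" for p
    using dist_mult[of "- w" "heis_mult w (dil r q)" p]
      dist_dil[OF r, of q "dil (1/r) (heis_mult (- w) p)"] r by simp
  with r show ?thesis by (auto simp: image_heis_mult image_dil)
qed

end

locale rotational_metric = homogeneous_metric \<rho> for \<rho> :: "'n::finite heis \<Rightarrow> 'n heis \<Rightarrow> real" +
  assumes rotational: "rotationally_invariant \<rho>"
begin

lemma dist_0_cong: "norm (x, y) = norm (x', y') \<Longrightarrow> \<rho> 0 (x, y, t) = \<rho> 0 (x', y', t)"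
  using rotational unfolding rotationally_invariant_def by blast

lemma dist_0_le:
  obtains C where "C \<ge> 0" "\<And>x y t. \<rho> 0 (x, y, t) \<le> C * (norm (x, y) + sqrt \<bar>t\<bar>)"
proof -
  obtain e :: "real^'n" where e: "norm e = 1" by (rule vector_choose_size[of 1]) simp_all
  \<comment> \<open>Both vertical directions are included because \<open>sgn t\<close> may be 1 or
    -1.\<close>
  define C where "C = \<rho> 0 (e, 0, 0) + \<rho> 0 (0, 0, 1) + \<rho> 0 (0, 0, -1)"
  have "C \<ge> 0" by (simp add: C_def)
  have "\<rho> 0 (x, y, t) \<le> C * (norm (x, y) + sqrt \<bar>t\<bar>)" for x y t
  proof -
  have "\<rho> 0 (x, y, 0) = norm (x, y) * \<rho> 0 (e, 0, 0)"
  proof (cases "norm (x, y) = 0")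
    case True
    then have "(x, y, 0::real) = 0" by (simp add: zero_prod_def)
    with True show ?thesis by simp
  next
    case False
    have "\<rho> 0 (x, y, 0) = \<rho> 0 (norm (x, y) *\<^sub>R e, 0, 0)"
      by (rule dist_0_cong) (simp add: e norm_Pair)
    also have "\<dots> = \<rho> 0 (dil (norm (x, y)) (e, 0, 0))" by (simp add: dil_Pair)
    also have "\<dots> = norm (x, y) * \<rho> 0 (e, 0, 0)"
      using False by (intro dist_0_dil) (metis norm_ge_zero less_eq_real_def)
    finally show ?thesis .
  qed
  moreover have "\<rho> 0 (0, 0, t) = sqrt \<bar>t\<bar> * \<rho> 0 (0, 0, sgn t)"
  proof (cases "t = 0")
    case False
    then have "(0, 0, t) = dil (sqrt \<bar>t\<bar>) (0, 0, sgn t)" by (simp add: dil_Pair abs_mult_sgn)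
    then show ?thesis using dist_0_dil[of "sqrt \<bar>t\<bar>" "(0, 0, sgn t)"] False
      by (metis real_sqrt_gt_zero zero_less_abs_iff)
  qed (simp flip: zero_prod_def)
  moreover have "\<rho> 0 (x, y, t) \<le> \<rho> 0 (x, y, 0) + \<rho> 0 (0, 0, t)"
    using dist_0_mult_le[of "(x, y, 0)" "(0, 0, t)"] by (simp add: heis_mult_Pair)
  moreover have "norm (x, y) * \<rho> 0 (e, 0, 0) \<le> norm (x, y) * C"
    by (intro mult_left_mono) (simp_all add: C_def)
  moreover have "sqrt \<bar>t\<bar> * \<rho> 0 (0, 0, sgn t) \<le> sqrt \<bar>t\<bar> * C"
    by (intro mult_left_mono) (auto simp add: C_def sgn_real_def simp flip: zero_prod_def)
  ultimately show ?thesis by (simp add: algebra_simps)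
  qed
  with \<open>C \<ge> 0\<close> show thesis by (rule that)
qed

lemma tendsto_dist_0: "(\<rho> 0 \<longlongrightarrow> 0) (nhds 0)"
proof -
  obtain C where C: "\<And>x y t. \<rho> 0 (x, y, t) \<le> C * (norm (x, y) + sqrt \<bar>t\<bar>)"
    by (rule dist_0_le) blast
  let ?h = "\<lambda>p :: 'n heis. C * (norm (fst p, fst (snd p)) + sqrt \<bar>snd (snd p)\<bar>)"
  have "isCont ?h 0" by (intro continuous_intros)
  then have "(?h \<longlongrightarrow> ?h 0) (nhds 0)"
    unfolding isCont_def by (subst (asm) tendsto_at_iff_tendsto_nhds)
  then have lim: "(?h \<longlongrightarrow> 0) (nhds 0)" by (simp add: zero_prod_def)
  have le: "\<rho> 0 p \<le> ?h p" for p by (cases p) (simp add: C)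
  show ?thesis
    by (rule tendsto_sandwich[OF _ _ tendsto_const lim])
       (intro always_eventually allI nonneg le)+
qed

text \<open>By the triangle inequality \<open>\<rho> p u\<close> and \<open>\<rho> p q\<close>
  differ by at most \<open>\<rho> q u\<close>, and left invariance turns this into a limit of
  \<open>\<rho> 0\<close> at the origin. Balls are thereby open, closed and Borel in the Euclidean
  topology.\<close>

lemma continuous_on_dist [continuous_intros]:
  assumes "continuous_on S f"
  shows "continuous_on S (\<lambda>x. \<rho> p (f x))"
proof -
  have "isCont (\<rho> p) q" for q
  proof -
    have "isCont (\<lambda>u. heis_mult (- q) u) q"
      using continuous_on_heis_mult[of UNIV "\<lambda>_. - q" "\<lambda>u. u"]
      by (simp add: continuous_on_eq_continuous_at continuous_on_id del: split_paired_All)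
    then have "((\<lambda>u. heis_mult (- q) u) \<longlongrightarrow> 0) (at q)" by (simp add: isCont_def)
    then have "((\<lambda>u. \<rho> 0 (heis_mult (- q) u)) \<longlongrightarrow> 0) (at q)"
      by (rule filterlim_compose[OF tendsto_dist_0])
    then have lim: "((\<lambda>u. \<rho> q u) \<longlongrightarrow> 0) (at q)" by (simp flip: dist_eq)
    have "((\<lambda>u. \<rho> p u - \<rho> p q) \<longlongrightarrow> 0) (at q)"
    proof (rule Lim_null_comparison[OF always_eventually lim], rule allI)
      fix u show "norm (\<rho> p u - \<rho> p q) \<le> \<rho> q u"
        using triangle[of p q u] triangle[of p u q] by (auto simp: commute)
    qed
    then show ?thesis unfolding isCont_def by (rule LIM_zero_cancel)
  qed
  then have "continuous_on UNIV (\<rho> p)" by (simp add: continuous_on_eq_continuous_at)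
  then show ?thesis by (rule continuous_on_compose2[OF _ assms subset_UNIV])
qed

lemma open_mball: "open (mball p r)"
proof -
  have "mball p r = {q. \<rho> p q < r}" by auto
  moreover have "open {q. \<rho> p q < r}" by (intro open_Collect_less continuous_intros)
  ultimately show ?thesis by simp
qed

lemma closed_mcball: "closed (mcball p r)"
proof -
  have "mcball p r = {q. \<rho> p q \<le> r}" by auto
  moreover have "closed {q. \<rho> p q \<le> r}" by (intro closed_Collect_le continuous_intros)
  ultimately show ?thesis by simp
qed

text \<open>The continuous function \<open>\<rho> 0\<close> has a positive minimum on the compact
  unit sphere \<open>K\<close> of the gauge \<open>h\<close>. Both sides scale alike under
  dilations, so the bound extends to all points.\<close>

lemma dist_0_ge:
  obtains c where "c > 0" "\<And>x y t. c * (norm (x, y) + sqrt \<bar>t\<bar>) \<le> \<rho> 0 (x, y, t)"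
proof -
  define h where "h = (\<lambda>p :: 'n heis. norm (fst p, fst (snd p)) + sqrt \<bar>snd (snd p)\<bar>)"
  have cont: "continuous_on UNIV h" unfolding h_def by (intro continuous_intros)
  define K where "K = {p. h p = 1}"
  have "closed K" unfolding K_def by (intro closed_Collect_eq cont continuous_intros)
  moreover have "bounded K"
  proof (rule boundedI)
    fix p assume "p \<in> K"
    obtain x y t where p: "p = (x, y, t)" by (cases p) auto
    have 1: "norm (x, y) + sqrt \<bar>t\<bar> = 1" using \<open>p \<in> K\<close> by (simp add: K_def h_def p)
    then have "sqrt \<bar>t\<bar> \<le> 1" "norm (x, y) \<le> 1" 
      using norm_ge_zero[of "(x, y)"] real_sqrt_ge_zero[of "\<bar>t\<bar>"] by linarith+
    then have "\<bar>t\<bar> \<le> 1" "norm x \<le> 1" "norm y \<le> 1"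
      using norm_fst_le[of x y] norm_snd_le[of y x] by (auto simp: real_sqrt_le_1_iff)
    then show "norm p \<le> 3" using norm_Pair_le[of x "(y, t)"] norm_Pair_le[of y t] by (simp add: p)
  qed
  ultimately have "compact K" by (simp add: compact_eq_bounded_closed)
  moreover have "(0, 0, 1) \<in> K" by (simp add: K_def h_def flip: zero_prod_def)
  then have "K \<noteq> {}" by auto
  moreover have "continuous_on K (\<rho> 0)" by (intro continuous_intros)
  ultimately obtain p0 where p0: "p0 \<in> K" "\<And>p. p \<in> K \<Longrightarrow> \<rho> 0 p0 \<le> \<rho> 0 p"
    using continuous_attains_inf[of K "\<rho> 0"] by blast
  have "p0 \<noteq> 0" using p0(1) by (auto simp: K_def h_def zero_prod_def)
  then have "\<rho> 0 p0 > 0" using mdist_pos_less[of 0 p0] by simp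
  moreover have "\<rho> 0 p0 * (norm (x, y) + sqrt \<bar>t\<bar>) \<le> \<rho> 0 (x, y, t)" for x y t
  proof (cases "norm (x, y) + sqrt \<bar>t\<bar> = 0")
    case False
    define s where "s = norm (x, y) + sqrt \<bar>t\<bar>"
    have s: "s > 0" using False unfolding s_def
      by (metis abs_ge_zero add_nonneg_nonneg norm_ge_zero order_le_less real_sqrt_ge_zero)
    have "norm ((1/s) *\<^sub>R x, (1/s) *\<^sub>R y) = norm (x, y) / s"
      using s norm_scaleR[of "1/s" "(x, y)"] by simp
    moreover have "sqrt \<bar>(1/s)\<^sup>2 * t\<bar> = sqrt \<bar>t\<bar> / s"
      using s by (simp add: abs_mult real_sqrt_mult real_sqrt_divide)
    ultimately have "h (dil (1/s) (x, y, t)) = 1" using s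
      by (simp add: dil_Pair h_def flip: add_divide_distrib s_def)
    then have "\<rho> 0 p0 \<le> \<rho> 0 (dil (1/s) (x, y, t))" by (intro p0) (simp add: K_def)
    also have "\<dots> = (1/s) * \<rho> 0 (x, y, t)" using s by (intro dist_0_dil) simp
    finally show ?thesis using s by (simp add: s_def field_simps)
  qed simp
  ultimately show thesis using that by blast
qed

end

section \<open>Spherical measure on subgroups with a homogeneous Haar measure\<close>

lemma spherical_premeasure_mono:
  "E \<subseteq> F \<Longrightarrow> spherical_premeasure \<rho> d \<delta> E \<le> spherical_premeasure \<rho> d \<delta> F"
  unfolding spherical_premeasure_def by (intro Inf_superset_mono) blast

lemma spherical_premeasure_le_sums:
  assumes "E \<subseteq> (\<Union>j. Metric_space.mcball UNIV \<rho> (x j) (r j))"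
    and "\<And>j. 0 < r j" "\<And>j. 2 * r j < \<delta>"
  shows "spherical_premeasure \<rho> d \<delta> E \<le> (\<Sum>j::nat. ennreal ((2 * r j) ^ d))"
  unfolding spherical_premeasure_def by (intro Inf_lower) (use assms in blast)

lemma spherical_premeasure_Un_mcball:
  assumes r: "0 < r" "2 * r < \<delta>"
  shows "spherical_premeasure \<rho> d \<delta> (E \<union> Metric_space.mcball UNIV \<rho> x r) \<le>
         spherical_premeasure \<rho> d \<delta> E + ennreal ((2 * r) ^ d)"
proof -
  let ?cb = "Metric_space.mcball UNIV \<rho>"
  \<comment> \<open>With the cost of the new ball moved to the left, the claim is a lower bound for
    an infimum and can be checked on each cover of \<open>E\<close>, extended by the new ball at
    index 0.\<close>
  have "spherical_premeasure \<rho> d \<delta> (E \<union> ?cb x r) - ennreal ((2 * r) ^ d) \<le>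
      (\<Sum>j. ennreal ((2 * s j) ^ d))"
    if s: "E \<subseteq> (\<Union>j. ?cb (y j) (s j))" "\<forall>j. 0 < s j \<and> 2 * s j < \<delta>" for y s
  proof -
    define y' where "y' = case_nat x y"
    define s' where "s' = case_nat r s"
    have "E \<union> ?cb x r \<subseteq> (\<Union>j. ?cb (y' j) (s' j))"
    proof
      fix p assume "p \<in> E \<union> ?cb x r"
      then consider "p \<in> ?cb x r" | j where "p \<in> ?cb (y j) (s j)" using s(1) by blast
      then show "p \<in> (\<Union>j. ?cb (y' j) (s' j))"
      proof cases
        case 1
        then have "p \<in> ?cb (y' 0) (s' 0)" by (simp add: y'_def s'_def)
        then show ?thesis by blast
      next
        case (2 j)
        then have "p \<in> ?cb (y' (Suc j)) (s' (Suc j))" by (simp add: y'_def s'_def)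
        then show ?thesis by blast
      qed
    qed
    moreover have "0 < s' j" "2 * s' j < \<delta>" for j
      using s(2) r by (auto simp: s'_def split: nat.split)
    ultimately have "spherical_premeasure \<rho> d \<delta> (E \<union> ?cb x r) \<le> (\<Sum>j. ennreal ((2 * s' j) ^ d))"
      by (rule spherical_premeasure_le_sums)
    also have "\<dots> = ennreal ((2 * r) ^ d) + (\<Sum>j. ennreal ((2 * s j) ^ d))"
      by (subst suminf_offset[of _ 1]) (simp_all add: s'_def)
    finally show ?thesis by (simp add: ennreal_minus_le_iff add.commute)
  qed
  then have "spherical_premeasure \<rho> d \<delta> (E \<union> ?cb x r) - ennreal ((2 * r) ^ d) \<le>
      spherical_premeasure \<rho> d \<delta> E"
    by (subst (2) spherical_premeasure_def) (auto intro!: Inf_greatest)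
  then show ?thesis by (simp add: ennreal_minus_le_iff add.commute)
qed

lemma spherical_premeasure_Un_mcballs:
  assumes "finite J" "\<And>i. i \<in> J \<Longrightarrow> 0 < r i \<and> 2 * r i < \<delta>"
  shows "spherical_premeasure \<rho> d \<delta> (E \<union> (\<Union>i\<in>J. Metric_space.mcball UNIV \<rho> (x i) (r i))) \<le>
         spherical_premeasure \<rho> d \<delta> E + ennreal (\<Sum>i\<in>J. (2 * r i) ^ d)"
  using assms
proof (induction J rule: finite_induct)
  case (insert i J)
  let ?U = "E \<union> (\<Union>i\<in>J. Metric_space.mcball UNIV \<rho> (x i) (r i))"
  have "spherical_premeasure \<rho> d \<delta> (?U \<union> Metric_space.mcball UNIV \<rho> (x i) (r i)) \<le>
      spherical_premeasure \<rho> d \<delta> ?U + ennreal ((2 * r i) ^ d)"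
    using insert.prems by (intro spherical_premeasure_Un_mcball) auto
  also have "\<dots> \<le> spherical_premeasure \<rho> d \<delta> E + ennreal (\<Sum>i\<in>J. (2 * r i) ^ d) + ennreal ((2 * r i) ^ d)"
    using insert by (intro add_right_mono insert.IH) auto
  also have "\<dots> = spherical_premeasure \<rho> d \<delta> E + ennreal (\<Sum>i\<in>insert i J. (2 * r i) ^ d)"
  proof -
    have "(\<Sum>i\<in>J. (2 * r i) ^ d) \<ge> 0" "(2 * r i) ^ d \<ge> 0"
      using insert.prems by (auto intro!: sum_nonneg zero_le_power simp: less_imp_le)
    with insert.hyps show ?thesis by (simp add: ennreal_plus[symmetric] add_ac del: ennreal_plus)
  qed
  finally show ?case by (simp add: Un_ac)
qed simp

text \<open>The radii of a cover are positive, so the indices outside \<open>I\<close> carry balls of arbitrarily small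
  total contribution.\<close>

lemma spherical_premeasure_le_sums_on:
  fixes I :: "nat set"
  assumes "E \<subseteq> (\<Union>j\<in>I. Metric_space.mcball UNIV \<rho> (x j) (r j))"
    and r: "\<And>j. j \<in> I \<Longrightarrow> 0 < r j" "\<And>j. j \<in> I \<Longrightarrow> 2 * r j < \<delta>"
    and "0 < \<delta>" "0 < d"
  shows "spherical_premeasure \<rho> d \<delta> E \<le> (\<Sum>j. if j \<in> I then ennreal ((2 * r j) ^ d) else 0)"
    (is "_ \<le> ?S")
proof (rule ennreal_le_epsilon)
  fix e :: real assume "0 < e"
  \<comment> \<open>The first bound keeps the diameters below \<open>\<delta>\<close>. The bound 1/2
    gives \<open>(2 * t j) ^ d \<le> 2 * t j\<close>, since \<open>d\<close> is positive, and the
    last makes these terms sum to at most \<open>e\<close>.\<close>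
  define t where "t j = min (\<delta> / 4) (min (1/2) (e * (1/2) ^ Suc j / 2))" for j :: nat
  define r' where "r' j = (if j \<in> I then r j else t j)" for j
  have t: "0 < t j" "2 * t j < \<delta>" "2 * t j \<le> 1" "2 * t j \<le> e * (1/2) ^ Suc j" for j
    using \<open>0 < e\<close> \<open>0 < \<delta>\<close> by (auto simp: t_def min_def)
  have tp: "(2 * t j) ^ d \<le> e * (1/2) ^ Suc j" for j
    using power_decreasing[of 1 d "2 * t j"] t[of j] \<open>0 < d\<close> by simp
  have "spherical_premeasure \<rho> d \<delta> E \<le> (\<Sum>j. ennreal ((2 * r' j) ^ d))"
  proof (rule spherical_premeasure_le_sums)
    show "E \<subseteq> (\<Union>j. Metric_space.mcball UNIV \<rho> (x j) (r' j))"
      using assms(1) by (force simp: r'_def)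
  qed (use r t in \<open>auto simp: r'_def\<close>)
  also have "\<dots> \<le> (\<Sum>j. (if j \<in> I then ennreal ((2 * r j) ^ d) else 0) + ennreal (e * (1/2) ^ Suc j))"
    using tp \<open>0 < e\<close> by (intro suminf_le) (auto simp: r'_def intro: ennreal_leI)
  also have "\<dots> = ?S + (\<Sum>j. ennreal (e * (1/2) ^ Suc j))"
    by (rule suminf_add[symmetric]) auto
  also have "(\<Sum>j. ennreal (e * (1/2) ^ Suc j)) = ennreal e"
    using sums_mult[OF power_half_series, of e] \<open>0 < e\<close>
    by (intro suminf_ennreal_eq) auto
  finally show "spherical_premeasure \<rho> d \<delta> E \<le> ?S + ennreal e" .
qed

text \<open>The measure lives on the whole group and is concentrated on \<open>P\<close>, so balls
  centred off \<open>P\<close> can be measured without intersecting them first. Translations are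
  restricted to elements of \<open>P\<close>; \<open>d\<close> plays the role of the homogeneous
  dimension of \<open>P\<close>.\<close>

locale homogeneous_haar = rotational_metric \<rho>
  for \<rho> :: "'n::finite heis \<Rightarrow> 'n heis \<Rightarrow> real" +
  fixes P :: "'n heis set" and \<mu> :: "'n heis measure" and d :: nat
  assumes zero_in: "0 \<in> P"
    and borel_P [measurable]: "P \<in> sets borel"
    and sets_\<mu> [measurable_cong]: "sets \<mu> = sets borel"
    and emeasure_Compl_P: "emeasure \<mu> (- P) = 0"
    and emeasure_mult_image:
      "w \<in> P \<Longrightarrow> E \<in> sets borel \<Longrightarrow> emeasure \<mu> (heis_mult w ` E) = emeasure \<mu> E"
    and emeasure_dil_image:
      "0 < r \<Longrightarrow> E \<in> sets borel \<Longrightarrow> emeasure \<mu> (dil r ` E) = ennreal (r ^ d) * emeasure \<mu> E"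
    and emeasure_unit_mball: "0 < emeasure \<mu> (mball 0 1)"
    and emeasure_unit_mcball: "emeasure \<mu> (mcball 0 1) < \<infinity>"
    and d_pos: "0 < d"
begin

lemma borel_mball [measurable]: "mball x r \<in> sets borel"
  by (rule borel_open) (rule open_mball)

lemma borel_mcball [measurable]: "mcball x r \<in> sets borel"
  by (rule borel_closed) (rule closed_mcball)

lemma borel_dil_image: "0 < r \<Longrightarrow> E \<in> sets borel \<Longrightarrow> dil r ` E \<in> sets borel"
  using measurable_sets[OF borel_measurable_dil[of "1/r"], of E] by (simp add: image_dil)

lemma emeasure_Int_P: "E \<in> sets borel \<Longrightarrow> emeasure \<mu> (E \<inter> P) = emeasure \<mu> E"
proof -
  assume E: "E \<in> sets borel"
  have "AE x in \<mu>. x \<in> P"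
    by (rule AE_I[of _ _ "- P"]) (auto simp: emeasure_Compl_P sets_\<mu> borel_P)
  then show ?thesis using E by (intro emeasure_eq_AE) (auto simp: sets_\<mu>)
qed

lemma emeasure_mball: "x \<in> P \<Longrightarrow> 0 < r \<Longrightarrow> emeasure \<mu> (mball x r) = ennreal (r ^ d) * emeasure \<mu> (mball 0 1)"
  using emeasure_mult_image[of x "dil r ` mball 0 1"] emeasure_dil_image[of r "mball 0 1"]
  by (simp add: mball_image borel_dil_image)

lemma emeasure_mcball:
  "w \<in> P \<Longrightarrow> 0 < r \<Longrightarrow>
    emeasure \<mu> (mcball (heis_mult w (dil r q)) r) = ennreal (r ^ d) * emeasure \<mu> (mcball q 1)"
  using emeasure_mult_image[of w "dil r ` mcball q 1"] emeasure_dil_image[of r "mcball q 1"]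
  by (simp add: mcball_image borel_dil_image)

text \<open>A unit ball either misses \<open>P\<close> or lies in the ball of radius 2 about one of
  its points in \<open>P\<close>, where invariance applies. This uniform bound makes the supremum
  over all centres finite.\<close>

lemma emeasure_mcball_le: "emeasure \<mu> (mcball q 1) \<le> ennreal (2 ^ d) * emeasure \<mu> (mcball 0 1)"
proof (cases "mcball q 1 \<inter> P = {}")
  case True
  then show ?thesis using emeasure_Int_P[of "mcball q 1"] by simp
next
  case False
  then obtain w where w: "w \<in> P" "\<rho> q w \<le> 1" by auto
  have "mcball q 1 \<subseteq> mcball w 2"
  proof
    fix p assume "p \<in> mcball q 1"
    then show "p \<in> mcball w 2" using triangle[of w q p] w(2) by (simp add: commute)
  qed
  then have "emeasure \<mu> (mcball q 1) \<le> emeasure \<mu> (mcball w 2)"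
    by (intro emeasure_mono) (auto simp: sets_\<mu>)
  also have "\<dots> = ennreal (2 ^ d) * emeasure \<mu> (mcball 0 1)"
    using emeasure_mcball[OF w(1), of 2 0] by simp
  finally show ?thesis .
qed

lemma emeasure_mcball_finite: "emeasure \<mu> (mcball q 1) < \<infinity>"
  by (rule le_less_trans[OF emeasure_mcball_le])
     (use emeasure_unit_mcball in \<open>simp add: ennreal_mult_less_top\<close>)

lemma emeasure_mcball_eq: "emeasure \<mu> (mcball q 1) = ennreal (measure \<mu> (mcball q 1))"
  using emeasure_mcball_finite[of q] by (intro emeasure_eq_ennreal_measure) auto

definition unit_mass :: real where "unit_mass = measure \<mu> (mball 0 1)"

lemma emeasure_unit: "emeasure \<mu> (mball 0 1) = ennreal unit_mass"
proof -
  have "emeasure \<mu> (mball 0 1) \<le> emeasure \<mu> (mcball 0 1)"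
    by (intro emeasure_mono mball_subset_mcball) (auto simp: sets_\<mu>)
  then show ?thesis unfolding unit_mass_def
    using emeasure_unit_mcball by (intro emeasure_eq_ennreal_measure) (auto simp: top_unique)
qed

lemma unit_mass_pos: "0 < unit_mass"
  using emeasure_unit_mball by (simp add: emeasure_unit)

text \<open>Openness in \<open>P\<close> is phrased through balls of \<open>\<rho>\<close>, the form
  that the covering argument uses, with measurability carried along.\<close>

definition relatively_open :: "'n heis set \<Rightarrow> bool" where
  "relatively_open A \<longleftrightarrow> A \<in> sets borel \<and> A \<subseteq> P \<and> (\<forall>x\<in>A. \<exists>s>0. mball x s \<inter> P \<subseteq> A)"

lemma relatively_open_Diff_mcball:
  assumes "relatively_open A"
  shows "relatively_open (A - mcball y t)"
  unfolding relatively_open_def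
proof (intro conjI ballI)
  fix x assume x: "x \<in> A - mcball y t"
  then obtain s where s: "s > 0" "mball x s \<inter> P \<subseteq> A"
    using assms by (auto simp: relatively_open_def)
  define s' where "s' = min s (\<rho> y x - t)"
  have "s' > 0" using x s by (auto simp: s'_def)
  moreover have "mball x s' \<inter> P \<subseteq> A - mcball y t"
  proof
    fix p assume p: "p \<in> mball x s' \<inter> P"
    then have "\<rho> x p < s" "\<rho> x p < \<rho> y x - t" by (auto simp: s'_def)
    moreover have "\<rho> y x \<le> \<rho> y p + \<rho> x p" using triangle[of y p x] by (simp add: commute)
    ultimately show "p \<in> A - mcball y t" using s(2) p by auto
  qed
  ultimately show "\<exists>s>0. mball x s \<inter> P \<subseteq> A - mcball y t" by blast
qed (use assms in \<open>auto simp: relatively_open_def\<close>)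

lemma relatively_open_Diff_mcballs:
  "finite J \<Longrightarrow> relatively_open A \<Longrightarrow> relatively_open (A - (\<Union>i\<in>J. mcball (y i) (t i)))"
proof (induction J arbitrary: A rule: finite_induct)
  case (insert i J)
  from insert.IH[OF relatively_open_Diff_mcball[OF insert.prems, of "y i" "t i"]]
  show ?case by (simp add: Diff_eq Int_assoc)
qed simp

section \<open>Vitali covering of relatively open sets\<close>

text \<open>A Vitali-type covering in which the radius is a tenth of the (truncated) distance to the
  complement, hence varies so slowly that the threefold balls of a maximal disjoint family
  already cover.\<close>

lemma vitali_cover:
  assumes A: "relatively_open A" and "0 < \<delta>"
  shows "\<exists>(I :: nat set) x r.
    (\<forall>i\<in>I. x i \<in> A \<and> 0 < r i \<and> r i \<le> \<delta> \<and> mball (x i) (r i) \<inter> P \<subseteq> A) \<and>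
    disjoint_family_on (\<lambda>i. mball (x i) (r i) \<inter> P) I \<and> A \<subseteq> (\<Union>i\<in>I. mball (x i) (3 * r i))"
proof -
  define S where "S x = {s. 0 < s \<and> s \<le> \<delta> \<and> mball x (10 * s) \<inter> P \<subseteq> A}" for x
  define r where "r x = Sup (S x)" for x
  have bdd: "bdd_above (S x)" for x by (rule bdd_aboveI[of _ \<delta>]) (auto simp: S_def)
  have ne: "S x \<noteq> {}" if x: "x \<in> A" for x
  proof -
    obtain s where s: "s > 0" "mball x s \<inter> P \<subseteq> A"
      using A x unfolding relatively_open_def by blast
    then have "min \<delta> (s / 10) \<in> S x"
      using \<open>0 < \<delta>\<close> by (auto simp: S_def min_def subset_iff)
    then show ?thesis by blast
  qed
  have pos: "0 < r x" if x: "x \<in> A" for x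
  proof -
    obtain s where "s \<in> S x" using ne[OF x] by blast
    then show ?thesis using cSup_upper[OF _ bdd, of s x] by (auto simp: r_def S_def)
  qed
  have le: "r x \<le> \<delta>" if x: "x \<in> A" for x
    unfolding r_def using ne[OF x] by (rule cSup_least) (simp add: S_def)
  \<comment> \<open>The supremum need not belong to \<open>S x\<close>, but a point closer to
    \<open>x\<close> than \<open>r x\<close> is within some \<open>s\<close> from
    \<open>S x\<close>, hence in the corresponding tenfold ball.\<close>
  have sub: "mball x (r x) \<inter> P \<subseteq> A" if x: "x \<in> A" for x
  proof
    fix p assume p: "p \<in> mball x (r x) \<inter> P"
    then have "\<rho> x p < Sup (S x)" by (simp add: r_def)
    then obtain s where s: "s \<in> S x" "\<rho> x p < s" using less_cSup_iff[OF ne[OF x] bdd] by blast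
    from s(1) have "mball x (10 * s) \<inter> P \<subseteq> A" by (simp add: S_def)
    moreover have "\<rho> x p < 10 * s" using s(2) nonneg[of x p] by linarith
    ultimately show "p \<in> A" using p by auto
  qed
  have slow: "r x \<le> r y + \<rho> x y / 10" if "x \<in> A" "y \<in> A" for x y
    unfolding r_def[of x] using ne[OF \<open>x \<in> A\<close>]
  proof (rule cSup_least)
    fix s assume s: "s \<in> S x"
    show "s \<le> r y + \<rho> x y / 10"
    proof (cases "s \<le> \<rho> x y / 10")
      case True
      then show ?thesis using pos[OF \<open>y \<in> A\<close>] by simp
    next
      case False
      \<comment> \<open>Moving the centre from \<open>x\<close> to \<open>y\<close> costs
        \<open>\<rho> x y\<close> in the tenfold radius, hence a tenth of it in \<open>s\<close>;
        this makes \<open>r\<close> Lipschitz with constant 1/10.\<close>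
      have "mball y (10 * (s - \<rho> x y / 10)) \<subseteq> mball x (10 * s)"
      proof
        fix p assume "p \<in> mball y (10 * (s - \<rho> x y / 10))"
        then show "p \<in> mball x (10 * s)" using triangle[of x y p] by simp
      qed
      moreover have "s \<le> \<delta>" using s by (simp add: S_def)
      then have "s - \<rho> x y / 10 \<le> \<delta>" using nonneg[of x y] by linarith
      ultimately have "s - \<rho> x y / 10 \<in> S y" using s False by (auto simp: S_def)
      then have "s - \<rho> x y / 10 \<le> r y" unfolding r_def by (rule cSup_upper[OF _ bdd])
      then show ?thesis by simp
    qed
  qed
  define F where "F = {X. X \<subseteq> A \<and> disjoint_family_on (\<lambda>x. mball x (r x) \<inter> P) X}"
  have "\<exists>X\<in>F. \<forall>Y\<in>F. X \<subseteq> Y \<longrightarrow> Y = X"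
  proof (rule subset_Zorn_nonempty)
    have "{} \<in> F" by (simp add: F_def disjoint_family_on_def)
    then show "F \<noteq> {}" by blast
    fix C assume C: "C \<noteq> {}" "subset.chain F C"
    have "disjoint_family_on (\<lambda>x. mball x (r x) \<inter> P) (\<Union>C)"
    proof (unfold disjoint_family_on_def, intro ballI impI)
      fix x y assume "x \<in> \<Union>C" "y \<in> \<Union>C" "x \<noteq> y"
      then obtain X Y where XY: "X \<in> C" "Y \<in> C" "x \<in> X" "y \<in> Y" by blast
      then obtain Z where Z: "Z \<in> C" "x \<in> Z" "y \<in> Z"
        using C(2) unfolding subset_chain_def by blast
      then have "Z \<in> F" using C(2) unfolding subset_chain_def by blast
      then show "mball x (r x) \<inter> P \<inter> (mball y (r y) \<inter> P) = {}"
        using Z \<open>x \<noteq> y\<close> by (simp add: F_def disjoint_family_on_def)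
    qed
    moreover have "\<Union>C \<subseteq> A" using C(2) unfolding subset_chain_def F_def by blast
    ultimately show "\<Union>C \<in> F" by (simp add: F_def)
  qed
  then obtain X where X: "X \<in> F" and max: "\<And>Y. Y \<in> F \<Longrightarrow> X \<subseteq> Y \<Longrightarrow> Y = X" by blast
  have XA: "X \<subseteq> A" and disj: "disjoint_family_on (\<lambda>x. mball x (r x) \<inter> P) X"
    using X by (simp_all add: F_def)
  have AP: "A \<subseteq> P" using A by (simp add: relatively_open_def)
  have cover: "\<exists>x\<in>X. y \<in> mball x (3 * r x)" if y: "y \<in> A" for y
  proof (cases "y \<in> X")
    case True
    then show ?thesis using pos[OF y] by (intro bexI[of _ y]) auto
  next
    case False
    then have "insert y X \<notin> F" using max[of "insert y X"] by blast
    then have "\<not> disjoint_family_on (\<lambda>x. mball x (r x) \<inter> P) (insert y X)"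
      using XA y by (simp add: F_def)
    then obtain x where "x \<in> X" and ne: "(mball x (r x) \<inter> P) \<inter> (mball y (r y) \<inter> P) \<noteq> {}"
      using disj False unfolding disjoint_family_on_insert[OF False] by blast
    from ne obtain p where "\<rho> x p < r x" "\<rho> y p < r y" by auto
    then have "\<rho> x y < r x + r y" using triangle[of x p y] by (simp add: commute)
    moreover have "r y \<le> r x + \<rho> x y / 10"
      using slow[of y x] XA \<open>x \<in> X\<close> y by (auto simp: commute)
    moreover have "0 < r x" using pos XA \<open>x \<in> X\<close> by blast
    \<comment> \<open>Eliminating \<open>r y\<close> leaves 9/10 of \<open>\<rho> x y\<close> below
      \<open>2 * r x\<close>, and 20/9 is less than 3.\<close>
    ultimately have "\<rho> x y < 3 * r x" by argo
    then show ?thesis using \<open>x \<in> X\<close> by (intro bexI[of _ x]) auto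
  qed
  \<comment> \<open>Each ball contains a basis set around its centre. The centres lie in
    \<open>P\<close>, so disjointness of the balls within \<open>P\<close> forces these basis sets
    to be distinct.\<close>
  have "countable X"
  proof -
    obtain \<B> :: "'n heis set set" where \<B>: "countable \<B>" "topological_basis \<B>"
      using ex_countable_basis by blast
    have "\<exists>B\<in>\<B>. x \<in> B \<and> B \<subseteq> mball x (r x)" if "x \<in> X" for x
      using topological_basisE[OF \<B>(2) open_mball[of x "r x"], of x] pos[of x] XA that
      by (metis centre_in_mball_iff UNIV_I subsetD)
    then obtain B where B: "\<And>x. x \<in> X \<Longrightarrow> B x \<in> \<B> \<and> x \<in> B x \<and> B x \<subseteq> mball x (r x)" by metis
    have "inj_on B X"
    proof (rule inj_onI, rule ccontr)
      fix x y assume xy: "x \<in> X" "y \<in> X" "B x = B y" "x \<noteq> y"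
      then have "x \<in> mball x (r x) \<inter> P \<inter> (mball y (r y) \<inter> P)" using B[of x] B[of y] XA AP by blast
      then show False using disj xy unfolding disjoint_family_on_def by blast
    qed
    moreover have "countable (B ` X)" by (rule countable_subset[OF _ \<B>(1)]) (use B in blast)
    ultimately show ?thesis using countable_image_inj_on by blast
  qed
  \<comment> \<open>Indexing by a set \<open>I\<close> of naturals also accommodates finite and
    empty families.\<close>
  define x where "x = from_nat_into X"
  define I where "I = to_nat_on X ` X"
  have xI: "x i \<in> X" if "i \<in> I" for i
    using that \<open>countable X\<close> by (auto simp: x_def I_def)
  have inj: "inj_on x I"
    using \<open>countable X\<close> by (auto simp: inj_on_def x_def I_def)
  have imgx: "x ` I = X"
    using \<open>countable X\<close> by (force simp: x_def I_def image_image)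
  show ?thesis
  proof (rule exI[of _ I], rule exI[of _ x], rule exI[of _ "\<lambda>i. r (x i)"], intro conjI ballI)
    show "disjoint_family_on (\<lambda>i. mball (x i) (r (x i)) \<inter> P) I"
      using disj inj xI unfolding disjoint_family_on_def inj_on_def by metis
    show "A \<subseteq> (\<Union>i\<in>I. mball (x i) (3 * r (x i)))"
      using cover unfolding imgx[symmetric] by blast
  qed (use xI XA pos le sub in blast)+
qed

lemma emeasure_Int_mball:
  "x \<in> P \<Longrightarrow> 0 < r \<Longrightarrow> emeasure \<mu> (mball x r \<inter> P) = ennreal (r ^ d * unit_mass)"
  using unit_mass_pos
  by (simp add: emeasure_Int_P emeasure_mball emeasure_unit ennreal_mult)

text \<open>A crude bound that only serves to start the iteration: the threefold Vitali balls cover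
  \<open>A\<close>, have doubled radius \<open>6 * r i\<close>, and are paid for by the disjoint
  balls inside \<open>A\<close>, each of mass \<open>r i ^ d * unit_mass\<close>.\<close>

lemma spherical_premeasure_le_emeasure:
  assumes A: "relatively_open A" and "0 < \<delta>"
  shows "spherical_premeasure \<rho> d \<delta> A \<le> ennreal (6 ^ d / unit_mass) * emeasure \<mu> A"
proof -
  \<comment> \<open>Radii up to \<open>\<delta> / 10\<close> keep \<open>6 * r i\<close> strictly
    below \<open>\<delta>\<close>.\<close>
  have "0 < \<delta> / 10" using \<open>0 < \<delta>\<close> by simp
  from vitali_cover[OF A this] obtain I :: "nat set" and x r where
    xr': "\<forall>i\<in>I. x i \<in> A \<and> 0 < r i \<and> r i \<le> \<delta> / 10 \<and> mball (x i) (r i) \<inter> P \<subseteq> A"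
    and disj: "disjoint_family_on (\<lambda>i. mball (x i) (r i) \<inter> P) I"
    and cover: "A \<subseteq> (\<Union>i\<in>I. mball (x i) (3 * r i))"
    by blast
  have xr: "x i \<in> A" "0 < r i" "r i \<le> \<delta> / 10" "mball (x i) (r i) \<inter> P \<subseteq> A" if "i \<in> I" for i
    using xr' that by blast+
  have AP: "A \<subseteq> P" "A \<in> sets borel" using A by (simp_all add: relatively_open_def)
  define G where "G i = (if i \<in> I then mball (x i) (r i) \<inter> P else {})" for i
  have G: "disjoint_family G" "range G \<subseteq> sets \<mu>" "(\<Union>i. G i) \<subseteq> A"
    using disj xr(4) by (auto simp: G_def disjoint_family_on_def sets_\<mu>)
  have "spherical_premeasure \<rho> d \<delta> A \<le> (\<Sum>i. if i \<in> I then ennreal ((2 * (3 * r i)) ^ d) else 0)"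
  proof (rule spherical_premeasure_le_sums_on)
    show "A \<subseteq> (\<Union>i\<in>I. mcball (x i) (3 * r i))"
      using cover mball_subset_mcball by blast
    show "0 < 3 * r j" "2 * (3 * r j) < \<delta>" if "j \<in> I" for j
      using xr(2,3)[OF that] \<open>0 < \<delta>\<close> by auto
  qed (use d_pos \<open>0 < \<delta>\<close> in auto)
  also have "\<dots> = (\<Sum>i. ennreal (6 ^ d / unit_mass) * emeasure \<mu> (G i))"
  proof (rule suminf_cong)
    fix i
    show "(if i \<in> I then ennreal ((2 * (3 * r i)) ^ d) else 0) =
        ennreal (6 ^ d / unit_mass) * emeasure \<mu> (G i)"
    proof (cases "i \<in> I")
      case True
      then have "x i \<in> P" "0 < r i" using xr AP by auto
      then show ?thesis using True unit_mass_pos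
        by (simp add: G_def emeasure_Int_mball power_mult_distrib flip: ennreal_mult)
    qed (simp add: G_def)
  qed
  also have "\<dots> = ennreal (6 ^ d / unit_mass) * emeasure \<mu> (\<Union>i. G i)"
    using suminf_emeasure[OF G(2,1)] by simp
  also have "\<dots> \<le> ennreal (6 ^ d / unit_mass) * emeasure \<mu> A"
    using G AP by (intro mult_left_mono emeasure_mono) (auto simp: sets_\<mu>)
  finally show ?thesis .
qed

section \<open>The sharp constant of the spherical measure\<close>

text \<open>Copies of an almost optimal ball fill at least the fraction \<open>\<eta>\<close> of any relatively open set, and
  what remains is again relatively open. So the excess \<open>c\<close> over the optimal constant shrinks by the
  factor \<open>1 - \<eta>\<close>, and iteration removes it.\<close>

lemma spherical_premeasure_improve:
  assumes M: "0 < measure \<mu> (mcball q 1)" (is "0 < ?M") and "0 < \<delta>"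
  obtains \<eta> where "0 < \<eta>" "\<eta> \<le> 1/2"
    "\<And>A c. relatively_open A \<Longrightarrow> emeasure \<mu> A < \<infinity> \<Longrightarrow> 0 \<le> c \<Longrightarrow>
       (\<And>B. relatively_open B \<Longrightarrow> emeasure \<mu> B < \<infinity> \<Longrightarrow>
          spherical_premeasure \<rho> d \<delta> B \<le> ennreal ((2 ^ d / ?M + c) * measure \<mu> B)) \<Longrightarrow>
       spherical_premeasure \<rho> d \<delta> A \<le> ennreal ((2 ^ d / ?M + (1 - \<eta>) * c) * measure \<mu> A)"
proof -
  define \<kappa> where "\<kappa> = 2 ^ d / ?M"
  \<comment> \<open>Shrinking \<open>mcball q 1\<close> by \<open>r / R\<close> and translating it
    by \<open>x\<close> puts it inside the open ball of radius \<open>r\<close> about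
    \<open>x\<close>, because \<open>\<rho> 0 q + 1\<close> is strictly less than \<open>R\<close>.
    In addition \<open>R \<ge> 2\<close> makes the diameters of the copies admissible.\<close>
  define R where "R = \<rho> 0 q + 2"
  have R: "R \<ge> 2" unfolding R_def using nonneg[of 0 q] by linarith
  \<comment> \<open>The second entry is the filled fraction: finitely many threefold balls carry
    over half of the mass of \<open>A\<close>, and replacing each by its copy changes its mass by
    the factor \<open>?M / ((3 * R) ^ d * unit_mass)\<close>. The cap 1/2 keeps
    \<open>1 - \<eta>\<close> positive.\<close>
  define \<eta> where "\<eta> = min (1/2) (?M / (2 * (3 * R) ^ d * unit_mass))"
  have \<eta>: "0 < \<eta>" "\<eta> \<le> 1/2"
    using M R unit_mass_pos by (auto simp: \<eta>_def)
  show thesis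
  proof (rule that[OF \<eta>])
    fix A c assume A: "relatively_open A" and fin: "emeasure \<mu> A < \<infinity>" and c: "0 \<le> c"
      and IH: "\<And>B. relatively_open B \<Longrightarrow> emeasure \<mu> B < \<infinity> \<Longrightarrow>
          spherical_premeasure \<rho> d \<delta> B \<le> ennreal ((2 ^ d / ?M + c) * measure \<mu> B)"
    have AP: "A \<subseteq> P" "A \<in> sets borel" using A by (simp_all add: relatively_open_def)
    have emA: "emeasure \<mu> A = ennreal (measure \<mu> A)"
      using fin by (intro emeasure_eq_ennreal_measure) auto
    show "spherical_premeasure \<rho> d \<delta> A \<le> ennreal ((2 ^ d / ?M + (1 - \<eta>) * c) * measure \<mu> A)"
    proof (cases "measure \<mu> A = 0")
      case True
      with IH[OF A fin] show ?thesis by simp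
    next
      case False
      then have pos: "measure \<mu> A > 0" "\<delta> > 0" using measure_nonneg[of \<mu> A] \<open>0 < \<delta>\<close> by linarith+
      have "0 < \<delta> / 2" using pos by simp
      from vitali_cover[OF A this] obtain I :: "nat set" and x r where
        xr': "\<forall>i\<in>I. x i \<in> A \<and> 0 < r i \<and> r i \<le> \<delta> / 2 \<and> mball (x i) (r i) \<inter> P \<subseteq> A"
        and disj: "disjoint_family_on (\<lambda>i. mball (x i) (r i) \<inter> P) I"
        and cover: "A \<subseteq> (\<Union>i\<in>I. mball (x i) (3 * r i))"
        by blast
      have xr: "x i \<in> A" "0 < r i" "r i \<le> \<delta> / 2" "mball (x i) (r i) \<inter> P \<subseteq> A" if "i \<in> I" for i
        using xr' that by blast+
      define g where "g i = (if i \<in> I then r i ^ d else 0)" for i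
      have g0: "g i \<ge> 0" for i using xr(2)[of i] by (auto simp: g_def)
      have xP: "x i \<in> P" if "i \<in> I" for i using xr(1)[OF that] AP by auto
      have "emeasure \<mu> A \<le> emeasure \<mu> (\<Union>i. if i \<in> I then mball (x i) (3 * r i) else {})"
        using cover by (intro emeasure_mono) (auto simp: sets_\<mu>)
      also have "\<dots> \<le> (\<Sum>i. emeasure \<mu> (if i \<in> I then mball (x i) (3 * r i) else {}))"
        by (intro emeasure_subadditive_countably) (auto simp: sets_\<mu>)
      also have "\<dots> = (\<Sum>i. ennreal (3 ^ d * unit_mass * g i))"
      proof (rule suminf_cong)
        fix i
        show "emeasure \<mu> (if i \<in> I then mball (x i) (3 * r i) else {}) =
            ennreal (3 ^ d * unit_mass * g i)"
        proof (cases "i \<in> I")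
          case True
          then have "emeasure \<mu> (mball (x i) (3 * r i)) = ennreal ((3 * r i) ^ d * unit_mass)"
            using xP xr(2) unit_mass_pos by (simp add: emeasure_mball emeasure_unit ennreal_mult'')
          with True show ?thesis by (simp add: g_def power_mult_distrib mult_ac)
        qed (simp add: g_def)
      qed
      also have "\<dots> = (SUP n. \<Sum>i<n. ennreal (3 ^ d * unit_mass * g i))"
        by (rule suminf_eq_SUP)
      finally have "ennreal (measure \<mu> A) \<le> (SUP n. \<Sum>i<n. ennreal (3 ^ d * unit_mass * g i))"
        by (simp add: emA)
      \<comment> \<open>All threefold balls together carry at least the mass of \<open>A\<close>.
        Aiming at half of it leaves a strict gap, so a finite partial sum suffices.\<close>
      moreover have "ennreal (measure \<mu> A / 2) < ennreal (measure \<mu> A)"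
        using pos by (simp add: ennreal_less_iff)
      ultimately have "ennreal (measure \<mu> A / 2) < (SUP n. \<Sum>i<n. ennreal (3 ^ d * unit_mass * g i))"
        by simp
      then obtain n where "ennreal (measure \<mu> A / 2) < (\<Sum>i<n. ennreal (3 ^ d * unit_mass * g i))"
        by (auto simp: less_SUP_iff)
      then have n: "measure \<mu> A / 2 < (\<Sum>i<n. 3 ^ d * unit_mass * g i)"
        using g0 unit_mass_pos
        by (subst (asm) sum_ennreal) (auto simp: ennreal_less_iff)
      define J where "J = {i \<in> I. i < n}"
      have J: "finite J" "J \<subseteq> I" by (auto simp: J_def)
      define y where "y i = heis_mult (x i) (dil (r i / R) q)" for i
      define s where "s i = r i / R" for i
      define C where "C i = mcball (y i) (s i) \<inter> P" for i
      have s: "0 < s i" "2 * s i < \<delta>" if "i \<in> I" for i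
      proof -
        show "0 < s i" using xr(2)[OF that] R by (simp add: s_def)
        have "s i \<le> r i / 2" unfolding s_def using xr(2)[OF that] R by (intro divide_left_mono) auto
        then show "2 * s i < \<delta>" using xr(2,3)[OF that] by argo
      qed
      have C_sub: "C i \<subseteq> mball (x i) (r i) \<inter> P" if "i \<in> I" for i
      proof
        fix p assume p: "p \<in> C i"
        then have "\<rho> (y i) p \<le> s i" by (simp add: C_def)
        moreover have "\<rho> (x i) (y i) = s i * \<rho> 0 q"
          using dist_mult[of "x i" 0 "dil (s i) q"] dist_0_dil[OF s(1)[OF that], of q]
          by (simp add: y_def s_def)
        ultimately have "\<rho> (x i) p \<le> s i * \<rho> 0 q + s i" using triangle[of "x i" "y i" p] by simp
        also have "\<dots> < s i * R" using s(1)[OF that] by (simp add: R_def algebra_simps)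
        also have "\<dots> = r i" using R by (simp add: s_def)
        finally show "p \<in> mball (x i) (r i) \<inter> P" using p by (simp add: C_def)
      qed
      have C_borel: "C i \<in> sets borel" for i by (simp add: C_def)
      have disjC: "disjoint_family_on C J"
        using disj C_sub J unfolding disjoint_family_on_def by blast
      have emC: "emeasure \<mu> (C i) = ennreal (s i ^ d * ?M)" if "i \<in> I" for i
        using emeasure_mcball[OF xP[OF that] s(1)[OF that], of q] s(1)[OF that] M
        by (simp add: C_def emeasure_Int_P y_def s_def emeasure_mcball_eq flip: ennreal_mult)
      define u where "u = (\<Sum>i\<in>J. s i ^ d * ?M)"
      \<comment> \<open>Only finitely many closed balls are removed, so the remainder is relatively
        open and the bound with excess \<open>c\<close> applies to it.\<close>
      define B where "B = A - (\<Union>i\<in>J. mcball (y i) (s i))"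
      have CA: "(\<Union>i\<in>J. C i) \<subseteq> A" using C_sub xr(4) J by blast
      have BC: "B = A - (\<Union>i\<in>J. C i)" using AP by (auto simp: B_def C_def)
      have u0: "0 \<le> u" unfolding u_def using s(1) M J
        by (intro sum_nonneg mult_nonneg_nonneg zero_le_power) (auto simp: less_imp_le)
      have "emeasure \<mu> (\<Union>i\<in>J. C i) = (\<Sum>i\<in>J. emeasure \<mu> (C i))"
        using J disjC by (intro sum_emeasure[symmetric]) (auto simp: C_borel sets_\<mu>)
      also have "\<dots> = (\<Sum>i\<in>J. ennreal (s i ^ d * ?M))" using emC J by (intro sum.cong) auto
      also have "\<dots> = ennreal u" unfolding u_def using s(1) M J
        by (intro sum_ennreal mult_nonneg_nonneg zero_le_power) (auto simp: less_imp_le)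
      finally have emU: "emeasure \<mu> (\<Union>i\<in>J. C i) = ennreal u" .
      have emB: "emeasure \<mu> B = emeasure \<mu> A - ennreal u"
        unfolding BC emU[symmetric] using CA AP J emU
        by (intro emeasure_Diff) (auto simp: sets_\<mu> C_borel)
      then have finB: "emeasure \<mu> B < \<infinity>" using fin by (simp add: less_top[symmetric] emA)
      have "measure \<mu> (\<Union>i\<in>J. C i) = u" using emU u0 by (simp add: measure_def)
      then have mB: "measure \<mu> B = measure \<mu> A - u"
        unfolding BC using CA AP J fin C_borel by (subst measure_Diff) (auto simp: sets_\<mu>)
      have "spherical_premeasure \<rho> d \<delta> A \<le>
          spherical_premeasure \<rho> d \<delta> (B \<union> (\<Union>i\<in>J. mcball (y i) (s i)))"
        by (intro spherical_premeasure_mono) (auto simp: B_def)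
      also have "\<dots> \<le> spherical_premeasure \<rho> d \<delta> B + ennreal (\<Sum>i\<in>J. (2 * s i) ^ d)"
        using J s by (intro spherical_premeasure_Un_mcballs) auto
      \<comment> \<open>The copies cost exactly \<open>\<kappa>\<close> per unit of mass, without
        the excess \<open>c\<close>.\<close>
      also have "(\<Sum>i\<in>J. (2 * s i) ^ d) = \<kappa> * u"
        using M by (simp add: u_def \<kappa>_def sum_distrib_left power_mult_distrib)
      also have "spherical_premeasure \<rho> d \<delta> B + ennreal (\<kappa> * u) \<le>
          ennreal ((\<kappa> + c) * measure \<mu> B) + ennreal (\<kappa> * u)"
        unfolding \<kappa>_def B_def using J A finB
        by (intro add_right_mono IH relatively_open_Diff_mcballs) (auto simp: B_def)
      also have "\<dots> = ennreal ((\<kappa> + c) * measure \<mu> B + \<kappa> * u)"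
        using M c u0 by (intro ennreal_plus[symmetric]) (auto simp: \<kappa>_def)
      also have "\<dots> \<le> ennreal ((\<kappa> + (1 - \<eta>) * c) * measure \<mu> A)"
      proof (rule ennreal_leI)
        have "(\<Sum>i<n. g i) = (\<Sum>i\<in>J. r i ^ d)"
          by (rule sum.mono_neutral_cong_right) (auto simp: J_def g_def)
        then have u: "u = ?M / R ^ d * (\<Sum>i<n. g i)"
          by (simp add: u_def s_def power_divide flip: sum_distrib_right sum_divide_distrib)
        have "\<eta> * measure \<mu> A \<le> ?M / (2 * (3 * R) ^ d * unit_mass) * measure \<mu> A"
          by (intro mult_right_mono) (auto simp: \<eta>_def)
        also have "\<dots> = ?M / ((3 * R) ^ d * unit_mass) * (measure \<mu> A / 2)" by simp
        also have "\<dots> \<le> ?M / ((3 * R) ^ d * unit_mass) * (\<Sum>i<n. 3 ^ d * unit_mass * g i)"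
          using n M R unit_mass_pos by (intro mult_left_mono) auto
        also have "\<dots> = u"
          using R unit_mass_pos by (simp add: u power_mult_distrib sum_distrib_left[symmetric])
        \<comment> \<open>The total cost is \<open>(\<kappa> + c) * measure \<mu> A - c * u\<close>,
          so the filled mass \<open>u\<close> only has to be at least the fraction
          \<open>\<eta>\<close> of \<open>A\<close>.\<close>
        finally have "c * (\<eta> * measure \<mu> A) \<le> c * u" using c by (intro mult_left_mono)
        then show "(\<kappa> + c) * measure \<mu> B + \<kappa> * u \<le> (\<kappa> + (1 - \<eta>) * c) * measure \<mu> A"
          by (simp add: mB algebra_simps)
      qed
      finally show ?thesis by (simp add: \<kappa>_def)
    qed
  qed
qed

text \<open>Starting from the crude bound, each application of the improvement multiplies the excess
  by \<open>1 - \<eta>\<close>; since \<open>\<eta>\<close> is the same for all sets, the excess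
  tends to 0.\<close>

theorem spherical_premeasure_le:
  assumes A: "relatively_open A" and fin: "emeasure \<mu> A < \<infinity>" and "0 < \<delta>"
    and M: "0 < measure \<mu> (mcball q 1)"
  shows "spherical_premeasure \<rho> d \<delta> A \<le> ennreal (2 ^ d / measure \<mu> (mcball q 1) * measure \<mu> A)"
proof -
  let ?\<kappa> = "2 ^ d / measure \<mu> (mcball q 1)"
  obtain \<eta> where \<eta>: "0 < \<eta>" "\<eta> \<le> 1/2"
    and improve: "\<And>A c. relatively_open A \<Longrightarrow> emeasure \<mu> A < \<infinity> \<Longrightarrow> 0 \<le> c \<Longrightarrow>
       (\<And>B. relatively_open B \<Longrightarrow> emeasure \<mu> B < \<infinity> \<Longrightarrow>
          spherical_premeasure \<rho> d \<delta> B \<le> ennreal ((?\<kappa> + c) * measure \<mu> B)) \<Longrightarrow>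
       spherical_premeasure \<rho> d \<delta> A \<le> ennreal ((?\<kappa> + (1 - \<eta>) * c) * measure \<mu> A)"
    using spherical_premeasure_improve[OF M \<open>0 < \<delta>\<close>] by blast
  define c0 where "c0 = 6 ^ d / unit_mass"
  have c0: "c0 \<ge> 0" using unit_mass_pos by (simp add: c0_def)
  have "spherical_premeasure \<rho> d \<delta> B \<le> ennreal ((?\<kappa> + (1 - \<eta>) ^ n * c0) * measure \<mu> B)"
    if "relatively_open B" "emeasure \<mu> B < \<infinity>" for n B
    using that
  proof (induction n arbitrary: B)
    case 0
    have "emeasure \<mu> B = ennreal (measure \<mu> B)"
      using 0 by (intro emeasure_eq_ennreal_measure) auto
    then have "spherical_premeasure \<rho> d \<delta> B \<le> ennreal (c0 * measure \<mu> B)"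
      using spherical_premeasure_le_emeasure[OF 0(1) \<open>0 < \<delta>\<close>] c0
      by (simp add: c0_def flip: ennreal_mult)
    also have "\<dots> \<le> ennreal ((?\<kappa> + (1 - \<eta>) ^ 0 * c0) * measure \<mu> B)"
      by (intro ennreal_leI mult_right_mono) auto
    finally show ?case .
  next
    case (Suc n)
    from improve[OF Suc.prems, of "(1 - \<eta>) ^ n * c0"] Suc.IH c0 \<eta>
    show ?case by (simp add: mult_ac)
  qed
  note bound = this[OF A fin]
  have "(\<lambda>n. (?\<kappa> + (1 - \<eta>) ^ n * c0) * measure \<mu> A) \<longlonglongrightarrow> (?\<kappa> + 0 * c0) * measure \<mu> A"
    using \<eta> by (intro tendsto_intros LIMSEQ_realpow_zero) auto
  then have "(\<lambda>n. ennreal ((?\<kappa> + (1 - \<eta>) ^ n * c0) * measure \<mu> A)) \<longlonglongrightarrow>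
      ennreal ((?\<kappa> + 0 * c0) * measure \<mu> A)"
    by (rule tendsto_ennrealI)
  then have "spherical_premeasure \<rho> d \<delta> A \<le> ennreal ((?\<kappa> + 0 * c0) * measure \<mu> A)"
    by (rule LIMSEQ_le_const) (use bound in blast)
  then show ?thesis by simp
qed

text \<open>Dilating about 0 turns any ball into a unit ball, so a ball of radius \<open>r\<close>
  has mass at most \<open>r ^ d * M\<close>. Countable subadditivity then bounds the mass of
  \<open>A\<close> by the cost of any cover.\<close>

lemma spherical_premeasure_ge:
  assumes M: "\<And>q. measure \<mu> (mcball q 1) \<le> M" "0 < M" and A: "A \<in> sets borel"
  shows "ennreal (2 ^ d / M) * emeasure \<mu> A \<le> spherical_premeasure \<rho> d \<delta> A"
  unfolding spherical_premeasure_def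
proof (rule Inf_greatest, clarify)
  fix x :: "nat \<Rightarrow> 'n heis" and r :: "nat \<Rightarrow> real"
  assume cov: "A \<subseteq> (\<Union>j. mcball (x j) (r j))" and r: "\<forall>j. 0 < r j \<and> 2 * r j < \<delta>"
  have ball: "emeasure \<mu> (mcball (x j) (r j)) \<le> ennreal (r j ^ d * M)" for j
  proof -
    have "emeasure \<mu> (mcball (x j) (r j)) =
        ennreal (r j ^ d) * emeasure \<mu> (mcball (dil (1 / r j) (x j)) 1)"
      using emeasure_mcball[OF zero_in, of "r j" "dil (1 / r j) (x j)"] r
      by (simp add: less_imp_neq[symmetric])
    also have "\<dots> = ennreal (r j ^ d * measure \<mu> (mcball (dil (1 / r j) (x j)) 1))"
      using r by (simp add: emeasure_mcball_eq ennreal_mult less_imp_le)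
    also have "\<dots> \<le> ennreal (r j ^ d * M)"
      using M r by (intro ennreal_leI mult_left_mono) (auto simp: less_imp_le)
    finally show ?thesis .
  qed
  have "emeasure \<mu> A \<le> emeasure \<mu> (\<Union>j. mcball (x j) (r j))"
    using cov by (intro emeasure_mono) (auto simp: sets_\<mu>)
  also have "\<dots> \<le> (\<Sum>j. emeasure \<mu> (mcball (x j) (r j)))"
    by (intro emeasure_subadditive_countably) (auto simp: sets_\<mu>)
  also have "\<dots> \<le> (\<Sum>j. ennreal (r j ^ d * M))" by (intro suminf_le ball) auto
  finally have "ennreal (2 ^ d / M) * emeasure \<mu> A \<le> ennreal (2 ^ d / M) * (\<Sum>j. ennreal (r j ^ d * M))"
    by (rule mult_left_mono) simp
  also have "\<dots> = (\<Sum>j. ennreal ((2 * r j) ^ d))"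
  proof -
    have "ennreal (2 ^ d / M) * ennreal (r j ^ d * M) = ennreal ((2 * r j) ^ d)" for j
      using M r by (simp add: power_mult_distrib less_imp_le flip: ennreal_mult)
    then show ?thesis by (simp flip: ennreal_suminf_cmult)
  qed
  finally show "ennreal (2 ^ d / M) * emeasure \<mu> A \<le> (\<Sum>j. ennreal ((2 * r j) ^ d))" .
qed

text \<open>The centre runs through the whole group, as the covering balls may be centred off
  \<open>P\<close>.\<close>

definition max_mass :: real where "max_mass = (SUP q. measure \<mu> (mcball q 1))"

lemma measure_mcball_le_max_mass: "measure \<mu> (mcball q 1) \<le> max_mass"
  unfolding max_mass_def
proof (rule cSUP_upper)
  have "measure \<mu> (mcball p 1) \<le> 2 ^ d * measure \<mu> (mcball 0 1)" for p
    using emeasure_mcball_le[of p] unfolding emeasure_mcball_eq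
    by (simp flip: ennreal_mult)
  then show "bdd_above (range (\<lambda>q. measure \<mu> (mcball q 1)))" by (intro bdd_aboveI2)
qed simp

lemma max_mass_pos: "0 < max_mass"
proof -
  have "0 < emeasure \<mu> (mball 0 1)" by (rule emeasure_unit_mball)
  also have "\<dots> \<le> emeasure \<mu> (mcball 0 1)"
    by (intro emeasure_mono mball_subset_mcball) (auto simp: sets_\<mu>)
  also have "\<dots> = ennreal (measure \<mu> (mcball 0 1))" by (rule emeasure_mcball_eq)
  finally show ?thesis using measure_mcball_le_max_mass[of 0] by simp
qed

text \<open>For the upper bound, the estimate for a single centre is cleared of its denominator. It
  then holds for centres of mass 0 as well, and the supremum over centres can be taken. The result
  does not depend on \<open>\<delta>\<close>, so the limit defining the measure is that of a
  constant.\<close>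

theorem spherical_premeasure_eq:
  assumes A: "relatively_open A" and fin: "emeasure \<mu> A < \<infinity>" and "0 < \<delta>"
  shows "spherical_premeasure \<rho> d \<delta> A = ennreal (2 ^ d / max_mass * measure \<mu> A)"
proof (rule antisym)
  have emA: "emeasure \<mu> A = ennreal (measure \<mu> A)"
    using fin by (intro emeasure_eq_ennreal_measure) auto
  show "ennreal (2 ^ d / max_mass * measure \<mu> A) \<le> spherical_premeasure \<rho> d \<delta> A"
    using spherical_premeasure_ge[OF measure_mcball_le_max_mass max_mass_pos, of A \<delta>] A max_mass_pos
    by (simp add: emA relatively_open_def flip: ennreal_mult)
  \<comment> \<open>One centre of positive mass shows that the premeasure is finite, so it can be
    handled as a real number \<open>s\<close>.\<close>
  obtain q0 where "0 < measure \<mu> (mcball q0 1)"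
  proof -
    have "\<exists>q. 0 < measure \<mu> (mcball q 1)"
      using max_mass_pos unfolding max_mass_def
      by (metis (no_types, lifting) UNIV_not_empty cSUP_least linorder_not_less)
    then show thesis using that by blast
  qed
  then have "spherical_premeasure \<rho> d \<delta> A < \<infinity>"
    using spherical_premeasure_le[OF A fin \<open>0 < \<delta>\<close>, of q0] by (auto intro: le_less_trans)
  then obtain s where s: "0 \<le> s" "spherical_premeasure \<rho> d \<delta> A = ennreal s"
    by (cases "spherical_premeasure \<rho> d \<delta> A") auto
  have "s * measure \<mu> (mcball q 1) \<le> 2 ^ d * measure \<mu> A" for q
  proof (cases "measure \<mu> (mcball q 1) = 0")
    case False
    then have M: "0 < measure \<mu> (mcball q 1)" using measure_nonneg[of \<mu> "mcball q 1"] by linarith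
    have "s \<le> 2 ^ d / measure \<mu> (mcball q 1) * measure \<mu> A"
      using spherical_premeasure_le[OF A fin \<open>0 < \<delta>\<close> M] s by simp
    with M show ?thesis by (simp add: field_simps)
  qed simp
  have "s * max_mass \<le> 2 ^ d * measure \<mu> A"
  proof (cases "s = 0")
    case False
    then have "max_mass \<le> 2 ^ d * measure \<mu> A / s"
      unfolding max_mass_def using s \<open>\<And>q. s * measure \<mu> (mcball q 1) \<le> _\<close>
      by (intro cSUP_least) (auto simp: field_simps)
    with False s show ?thesis by (simp add: field_simps)
  qed simp
  then show "spherical_premeasure \<rho> d \<delta> A \<le> ennreal (2 ^ d / max_mass * measure \<mu> A)"
    using max_mass_pos by (simp add: s field_simps ennreal_leI)
qed

corollary spherical_measure_eq:
  assumes "relatively_open A" "emeasure \<mu> A < \<infinity>"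
  shows "spherical_measure \<rho> d A = ennreal (2 ^ d / max_mass * measure \<mu> A)"
proof -
  have "spherical_measure \<rho> d A = (SUP \<epsilon>\<in>{0::real<..}. ennreal (2 ^ d / max_mass * measure \<mu> A))"
    unfolding spherical_measure_eq_SUP
    by (rule SUP_cong) (simp_all add: spherical_premeasure_eq[OF assms])
  also have "\<dots> = ennreal (2 ^ d / max_mass * measure \<mu> A)"
    by (rule SUP_const) (rule greaterThan_non_empty)
  finally show ?thesis .
qed

end

section \<open>Lebesgue measure on vertical subgroups\<close>

text \<open>The pushforward of the product measure, weighted by \<open>r ^ card I\<close>, agrees
  with the product measure on boxes, where each coordinate contributes one factor \<open>r\<close>.
  The map is restricted to \<open>I\<close> because points of the product space are extensional
  functions.\<close>

lemma nn_integral_PiM_lborel_affine: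
  fixes f :: "('i \<Rightarrow> real) \<Rightarrow> ennreal"
  assumes I: "finite I" and r: "0 < r"
    and f [measurable]: "f \<in> borel_measurable (Pi\<^sub>M I (\<lambda>_. lborel))"
  shows "(\<integral>\<^sup>+c. f c \<partial>Pi\<^sub>M I (\<lambda>_. lborel)) =
    ennreal (r ^ card I) * (\<integral>\<^sup>+c. f (\<lambda>i\<in>I. a i + r * c i) \<partial>Pi\<^sub>M I (\<lambda>_. lborel))"
proof -
  let ?M = "Pi\<^sub>M I (\<lambda>_. lborel :: real measure)"
  let ?T = "\<lambda>c. \<lambda>i\<in>I. a i + r * c i"
  interpret product_sigma_finite "\<lambda>_::'i. lborel :: real measure" by standard
  have T [measurable]: "?T \<in> measurable ?M ?M" by measurable
  have "density (distr ?M ?M ?T) (\<lambda>_. ennreal (r ^ card I)) = ?M"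
  proof (rule PiM_eqI[OF I])
    fix A :: "'i \<Rightarrow> real set" assume A: "\<And>i. i \<in> I \<Longrightarrow> A i \<in> sets lborel"
    have A' [measurable]: "(\<lambda>x. a i + r * x) -` A i \<in> sets borel" if "i \<in> I" for i
      using measurable_sets_borel[of "\<lambda>x. a i + r * x" borel "A i"] A[OF that] by simp
    have scale: "emeasure lborel (A i) = ennreal r * emeasure lborel ((\<lambda>x. a i + r * x) -` A i)"
      if "i \<in> I" for i
    proof -
      have "emeasure lborel (A i) = (\<integral>\<^sup>+x. indicator (A i) x \<partial>lborel)"
        using A[OF that] by simp
      also have "\<dots> = ennreal \<bar>r\<bar> * (\<integral>\<^sup>+x. indicator (A i) (a i + r * x) \<partial>lborel)"
        using A[OF that] r by (intro nn_integral_real_affine) auto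
      also have "(\<integral>\<^sup>+x. indicator (A i) (a i + r * x) \<partial>lborel) =
          (\<integral>\<^sup>+x. indicator ((\<lambda>x. a i + r * x) -` A i) x \<partial>lborel)"
        by (intro nn_integral_cong) (simp add: indicator_def)
      finally show ?thesis using A'[OF that] r by simp
    qed
    have PA: "Pi\<^sub>E I A \<in> sets ?M" using A I by (intro sets_PiM_I_finite) auto
    have pre: "?T -` Pi\<^sub>E I A \<inter> space ?M = Pi\<^sub>E I (\<lambda>i. (\<lambda>x. a i + r * x) -` A i)"
      by (auto simp: space_PiM PiE_iff)
    have "emeasure (density (distr ?M ?M ?T) (\<lambda>_. ennreal (r ^ card I))) (Pi\<^sub>E I A) =
        ennreal (r ^ card I) * emeasure ?M (?T -` Pi\<^sub>E I A \<inter> space ?M)"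
      using PA by (simp add: emeasure_density_const emeasure_distr)
    also have "\<dots> = (\<Prod>i\<in>I. ennreal r) * (\<Prod>i\<in>I. emeasure lborel ((\<lambda>x. a i + r * x) -` A i))"
      unfolding pre using I A' r by (subst emeasure_PiM) (auto simp: ennreal_power)
    also have "\<dots> = (\<Prod>i\<in>I. emeasure lborel (A i))"
      by (subst prod.distrib[symmetric]) (simp add: scale)
    finally show "emeasure (density (distr ?M ?M ?T) (\<lambda>_. ennreal (r ^ card I))) (Pi\<^sub>E I A) =
        (\<Prod>i\<in>I. emeasure lborel (A i))" .
  qed simp
  then have "(\<integral>\<^sup>+c. f c \<partial>?M) =
      (\<integral>\<^sup>+c. f c \<partial>density (distr ?M ?M ?T) (\<lambda>_. ennreal (r ^ card I)))" by simp
  also have "\<dots> = (\<integral>\<^sup>+c. ennreal (r ^ card I) * f c \<partial>distr ?M ?M ?T)"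
    by (subst nn_integral_density) auto
  also have "\<dots> = (\<integral>\<^sup>+c. ennreal (r ^ card I) * f (?T c) \<partial>?M)"
    by (subst nn_integral_distr) auto
  also have "\<dots> = ennreal (r ^ card I) * (\<integral>\<^sup>+c. f (?T c) \<partial>?M)"
    by (rule nn_integral_cmult) measurable
  finally show ?thesis .
qed

lemma emeasure_lborel_vimage_affine:
  fixes T :: "real set"
  assumes "T \<in> sets borel" "0 < r"
  shows "emeasure lborel T = ennreal r * emeasure lborel {t. s + r * t \<in> T}"
proof -
  have "(\<lambda>t. s + r * t) -` T \<in> sets borel"
    using measurable_sets_borel[of "\<lambda>t. s + r * t" borel T] assms by simp
  then have m: "{t. s + r * t \<in> T} \<in> sets borel" by (simp add: vimage_def)
  have "emeasure lborel T = (\<integral>\<^sup>+x. indicator T x \<partial>lborel)" using assms by simp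
  also have "\<dots> = ennreal \<bar>r\<bar> * (\<integral>\<^sup>+x. indicator T (s + r * x) \<partial>lborel)"
    using assms by (intro nn_integral_real_affine) auto
  also have "(\<integral>\<^sup>+x. indicator T (s + r * x) \<partial>lborel) =
      (\<integral>\<^sup>+x. indicator {t. s + r * t \<in> T} x \<partial>lborel)"
    by (intro nn_integral_cong) (simp add: indicator_def)
  finally show ?thesis using m assms by simp
qed

text \<open>Together with \<open>lift\<close>, this regroups the nested triple as a vector of
  \<open>\<real>\<^sup>2\<^sup>n\<close> and a height, so that subspaces and inner products of
  \<open>\<real>\<^sup>2\<^sup>n\<close> become available.\<close>

definition horizontal_part :: "'n::finite heis \<Rightarrow> (real^'n) \<times> (real^'n)" where
  "horizontal_part p = (fst p, fst (snd p))"

definition lift :: "(real^'n::finite) \<times> (real^'n) \<Rightarrow> real \<Rightarrow> 'n heis" where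
  "lift z t = (fst z, snd z, t)"

lemma horizontal_part_lift [simp]: "horizontal_part (lift z t) = z"
  by (simp add: horizontal_part_def lift_def)

lemma lift_horizontal_part [simp]: "lift (horizontal_part p) (snd (snd p)) = p"
  by (simp add: horizontal_part_def lift_def)

lemma horizontal_part_mult [simp]:
  "horizontal_part (heis_mult p q) = horizontal_part p + horizontal_part q"
  by (cases p; cases q) (simp add: horizontal_part_def heis_mult_Pair)

lemma horizontal_part_simps [simp]:
  "horizontal_part (- p) = - horizontal_part p" "horizontal_part 0 = 0"
  "horizontal_part (dil r p) = r *\<^sub>R horizontal_part p"
  by (cases p; simp add: horizontal_part_def dil_Pair zero_prod_def)+

lemma dil_lift: "dil r (lift z t) = lift (r *\<^sub>R z) (r\<^sup>2 * t)"
  by (simp add: lift_def dil_Pair)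

lemma mult_lift: "heis_mult p (lift z t) = lift (horizontal_part p + z) (snd (snd (heis_mult p (lift z 0))) + t)"
  by (cases p) (simp add: lift_def heis_mult_Pair horizontal_part_def)

lemma borel_measurable_lift [measurable]:
  "(\<lambda>x. lift (fst x) (snd x)) \<in> borel_measurable (borel \<Otimes>\<^sub>M borel)"
  unfolding borel_prod lift_def
  by (intro borel_measurable_continuous_onI continuous_intros)

definition fibre_length :: "'n::finite heis set \<Rightarrow> (real^'n) \<times> (real^'n) \<Rightarrow> ennreal" where
  "fibre_length E z = emeasure lborel {t. lift z t \<in> E}"

lemma borel_fibre: "E \<in> sets borel \<Longrightarrow> {t. lift z t \<in> E} \<in> sets borel"
proof -
  assume "E \<in> sets borel"
  moreover have "lift z \<in> borel_measurable borel"
    unfolding lift_def by (intro borel_measurable_continuous_onI continuous_intros)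
  ultimately show ?thesis using measurable_sets_borel[of "lift z" borel E] by (simp add: vimage_def)
qed

lemma borel_measurable_fibre_length [measurable]:
  fixes E :: "'n::finite heis set"
  assumes E: "E \<in> sets borel"
  shows "fibre_length E \<in> borel_measurable borel"
proof -
  let ?E = "(\<lambda>x :: ((real^'n) \<times> (real^'n)) \<times> real. lift (fst x) (snd x)) -` E"
  have "?E \<in> sets (borel \<Otimes>\<^sub>M lborel)"
    using measurable_sets[OF borel_measurable_lift E]
    by (simp add: space_pair_measure cong: sets_pair_measure_cong)
  from lborel.measurable_emeasure_Pair[OF this]
  show ?thesis by (simp add: fibre_length_def[abs_def] vimage_def)
qed

text \<open>A left translation moves each vertical line onto another one by a shift whose size
  depends only on \<open>w\<close> and \<open>z\<close>, and Lebesgue measure ignores the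
  shift.\<close>

lemma fibre_length_mult_image:
  assumes "E \<in> sets borel"
  shows "fibre_length (heis_mult w ` E) z = fibre_length E (z - horizontal_part w)"
proof -
  let ?s = "snd (snd (heis_mult (- w) (lift z 0)))"
  have "{t. lift z t \<in> heis_mult w ` E} = {t. heis_mult (- w) (lift z t) \<in> E}"
    by (simp add: image_heis_mult)
  also have "\<dots> = {t. ?s + 1 * t \<in> {t. lift (z - horizontal_part w) t \<in> E}}"
    by (subst mult_lift) simp
  finally show ?thesis
    using emeasure_lborel_vimage_affine[OF borel_fibre[OF assms, of "z - horizontal_part w"], of 1 ?s]
    by (simp add: fibre_length_def)
qed

lemma fibre_length_dil_image:
  assumes E: "E \<in> sets borel" and r: "0 < r"
  shows "fibre_length (dil r ` E) z = ennreal (r\<^sup>2) * fibre_length E ((1 / r) *\<^sub>R z)"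
proof -
  let ?T = "{t. lift z t \<in> dil r ` E}"
  have "dil r ` E \<in> sets borel"
    using measurable_sets_borel[OF borel_measurable_dil[of "1/r"] E] r by (simp add: image_dil)
  then have "emeasure lborel ?T = ennreal (r\<^sup>2) * emeasure lborel {t. 0 + r\<^sup>2 * t \<in> ?T}"
    using r by (intro emeasure_lborel_vimage_affine borel_fibre) auto
  also have "{t. 0 + r\<^sup>2 * t \<in> ?T} = {t. lift ((1 / r) *\<^sub>R z) t \<in> E}"
    using r by (simp add: image_dil dil_lift power_divide)
  finally show ?thesis by (simp add: fibre_length_def)
qed

section \<open>Vertical layers in orthonormal coordinates\<close>

locale frame =
  fixes b :: "nat \<Rightarrow> (real^'n::finite) \<times> (real^'n)" and k :: nat
  assumes orthonormal: "\<And>i j. i < k \<Longrightarrow> j < k \<Longrightarrow> b i \<bullet> b j = (if i = j then 1 else 0)"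
begin

definition comb :: "(nat \<Rightarrow> real) \<Rightarrow> (real^'n) \<times> (real^'n)" where
  "comb c = (\<Sum>i<k. c i *\<^sub>R b i)"

abbreviation coords :: "(nat \<Rightarrow> real) measure" where
  "coords \<equiv> Pi\<^sub>M {..<k} (\<lambda>_. lborel)"

definition layer :: "'n heis set" where
  "layer = {p. horizontal_part p \<in> range comb}"

text \<open>Lebesgue measure of the product of the span of the frame with the vertical line, pushed
  forward to the whole group to fit \<open>homogeneous_haar\<close>.\<close>

definition layer_measure :: "'n heis measure" where
  "layer_measure = distr (coords \<Otimes>\<^sub>M lborel) borel (\<lambda>x. lift (comb (fst x)) (snd x))"

lemma comb_affine: "comb (\<lambda>i\<in>{..<k}. a i + r * c i) = comb a + r *\<^sub>R comb c"
  by (simp add: comb_def algebra_simps sum.distrib scaleR_sum_right)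

lemma comb_add: "comb (\<lambda>i. a i + c i) = comb a + comb c"
  by (simp add: comb_def algebra_simps sum.distrib)

lemma comb_scale: "comb (\<lambda>i. r * c i) = r *\<^sub>R comb c"
  by (simp add: comb_def scaleR_sum_right)

lemma inner_comb_b: "i < k \<Longrightarrow> comb c \<bullet> b i = c i"
proof -
  assume i: "i < k"
  have "comb c \<bullet> b i = (\<Sum>j<k. c j * (if j = i then 1 else 0))"
    unfolding comb_def inner_sum_left using i by (intro sum.cong) (simp_all add: orthonormal)
  then show ?thesis using i by (simp add: if_distrib cong: if_cong)
qed

lemma inner_comb: "comb c \<bullet> comb c' = (\<Sum>i<k. c i * c' i)"
  unfolding comb_def[of c'] inner_sum_right
  by (intro sum.cong) (simp_all add: inner_comb_b mult.commute)

lemma norm_comb_le: "norm (comb c) \<le> (\<Sum>i<k. \<bar>c i\<bar>)"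
  unfolding comb_def
proof (rule sum_norm_le)
  fix i assume "i \<in> {..<k}"
  then have "norm (b i) = 1" using orthonormal[of i i] by (simp add: norm_eq_sqrt_inner)
  then show "norm (c i *\<^sub>R b i) \<le> \<bar>c i\<bar>" by simp
qed

lemma abs_le_norm_comb: "i < k \<Longrightarrow> \<bar>c i\<bar> \<le> norm (comb c)"
  using Cauchy_Schwarz_ineq2[of "comb c" "b i"] orthonormal[of i i]
  by (simp add: inner_comb_b norm_eq_sqrt_inner)

lemma subspace_range_comb: "subspace (range comb)"
proof (rule subspaceI)
  show "0 \<in> range comb" by (rule image_eqI[of _ _ "\<lambda>_. 0"]) (simp_all add: comb_def)
qed (auto simp flip: comb_add comb_scale)

lemma borel_measurable_comb [measurable]: "comb \<in> borel_measurable coords"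
  unfolding comb_def
  by (intro borel_measurable_sum borel_measurable_scaleR) simp_all

lemma measurable_lift_comb [measurable]:
  "(\<lambda>x. lift (comb (fst x)) (snd x)) \<in> borel_measurable (coords \<Otimes>\<^sub>M lborel)"
proof -
  have "(\<lambda>x. (comb (fst x), snd x)) \<in> measurable (coords \<Otimes>\<^sub>M lborel) (borel \<Otimes>\<^sub>M borel)"
    by measurable
  from measurable_compose[OF this borel_measurable_lift] show ?thesis by simp
qed

lemma borel_layer: "layer \<in> sets borel"
proof -
  have "closed (range comb)" by (rule closed_subspace) (rule subspace_range_comb)
  moreover have "continuous_on UNIV (horizontal_part :: 'n heis \<Rightarrow> _)"
    unfolding horizontal_part_def by (intro continuous_intros)
  ultimately have "closed (horizontal_part -` range comb)" by (intro closed_vimage)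
  then show ?thesis by (simp add: layer_def vimage_def borel_closed)
qed

lemma sets_layer_measure [simp]: "sets layer_measure = sets borel"
  by (simp add: layer_measure_def)

text \<open>Tonelli's theorem, integrating along the vertical direction first; all later
  computations go through this formula.\<close>

lemma emeasure_layer_measure:
  assumes E: "E \<in> sets borel"
  shows "emeasure layer_measure E = (\<integral>\<^sup>+c. fibre_length E (comb c) \<partial>coords)"
proof -
  let ?E = "(\<lambda>x. lift (comb (fst x)) (snd x)) -` E \<inter> space (coords \<Otimes>\<^sub>M lborel)"
  have "emeasure layer_measure E = emeasure (coords \<Otimes>\<^sub>M lborel) ?E"
    unfolding layer_measure_def using E by (intro emeasure_distr) simp_all
  also have "\<dots> = (\<integral>\<^sup>+c. emeasure lborel (Pair c -` ?E) \<partial>coords)"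
    by (rule lborel.emeasure_pair_measure_alt[OF measurable_sets[OF measurable_lift_comb E]])
  also have "\<dots> = (\<integral>\<^sup>+c. fibre_length E (comb c) \<partial>coords)"
    by (intro nn_integral_cong arg_cong[of _ _ "emeasure lborel"])
       (auto simp: space_pair_measure fibre_length_def intro!: arg_cong[of _ _ "emeasure lborel"])
  finally show ?thesis .
qed

text \<open>\<open>w\<close> is arbitrary here, which is what makes balls centred off the layer
  computable.\<close>

lemma emeasure_layer_mult_image:
  assumes E: "E \<in> sets borel"
  shows "emeasure layer_measure (heis_mult w ` E) =
    (\<integral>\<^sup>+c. fibre_length E (comb c - horizontal_part w) \<partial>coords)"
proof -
  have "heis_mult w ` E \<in> sets borel"
    using measurable_sets_borel[OF borel_measurable_heis_mult[of "- w"] E] by (simp add: image_heis_mult)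
  then show ?thesis by (simp add: emeasure_layer_measure fibre_length_mult_image E)
qed

text \<open>Each of the \<open>k\<close> horizontal coordinates contributes \<open>r\<close> and the
  vertical one \<open>r\<^sup>2\<close>, whence the exponent \<open>k + 2\<close>.\<close>

lemma emeasure_layer_dil_image:
  assumes E: "E \<in> sets borel" and r: "0 < r"
  shows "emeasure layer_measure (dil r ` E) = ennreal (r ^ (k + 2)) * emeasure layer_measure E"
proof -
  note [measurable] = borel_measurable_fibre_length[OF E]
  have "dil r ` E \<in> sets borel"
    using measurable_sets_borel[OF borel_measurable_dil[of "1/r"] E] r by (simp add: image_dil)
  then have "emeasure layer_measure (dil r ` E) =
      (\<integral>\<^sup>+c. ennreal (r\<^sup>2) * fibre_length E ((1 / r) *\<^sub>R comb c) \<partial>coords)"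
    by (simp add: emeasure_layer_measure fibre_length_dil_image E r)
  also have "\<dots> = ennreal (r\<^sup>2) * (\<integral>\<^sup>+c. fibre_length E ((1 / r) *\<^sub>R comb c) \<partial>coords)"
    by (rule nn_integral_cmult) measurable
  also have "(\<integral>\<^sup>+c. fibre_length E ((1 / r) *\<^sub>R comb c) \<partial>coords) =
      ennreal (r ^ k) * (\<integral>\<^sup>+c. fibre_length E ((1 / r) *\<^sub>R comb (\<lambda>i\<in>{..<k}. 0 + r * c i)) \<partial>coords)"
    by (subst nn_integral_PiM_lborel_affine[of _ r _ "\<lambda>_. 0"]) (use r in simp_all)
  also have "(\<integral>\<^sup>+c. fibre_length E ((1 / r) *\<^sub>R comb (\<lambda>i\<in>{..<k}. 0 + r * c i)) \<partial>coords) =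
      emeasure layer_measure E"
    unfolding comb_affine emeasure_layer_measure[OF E] using r by (simp add: comb_def)
  finally have "emeasure layer_measure (dil r ` E) =
      ennreal (r\<^sup>2) * ennreal (r ^ k) * emeasure layer_measure E"
    by (simp only: mult.assoc)
  also have "ennreal (r\<^sup>2) * ennreal (r ^ k) = ennreal (r ^ (k + 2))"
    using r by (simp add: power_add power2_eq_square mult.commute flip: ennreal_mult)
  finally show ?thesis .
qed

text \<open>For \<open>w\<close> in the layer the horizontal shift is a translation of the
  coordinates and is absorbed by a change of variables.\<close>

lemma emeasure_layer_mult_image_same:
  assumes w: "w \<in> layer" and E: "E \<in> sets borel"
  shows "emeasure layer_measure (heis_mult w ` E) = emeasure layer_measure E"
proof -
  note [measurable] = borel_measurable_fibre_length[OF E]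
  obtain a where a: "horizontal_part w = comb a" using w by (auto simp: layer_def)
  have "emeasure layer_measure E =
      ennreal (1 ^ k) * (\<integral>\<^sup>+c. fibre_length E (comb (\<lambda>i\<in>{..<k}. - a i + 1 * c i)) \<partial>coords)"
    unfolding emeasure_layer_measure[OF E]
    by (subst nn_integral_PiM_lborel_affine[of _ 1 _ "\<lambda>i. - a i"]) simp_all
  also have "\<dots> = emeasure layer_measure (heis_mult w ` E)"
    unfolding comb_affine emeasure_layer_mult_image[OF E] a
    using comb_scale[of "- 1" a] by simp
  finally show ?thesis ..
qed

lemma emeasure_Compl_layer: "emeasure layer_measure (- layer) = 0"
proof -
  have "fibre_length (- layer) (comb c) = 0" for c by (simp add: fibre_length_def layer_def)
  then show ?thesis using borel_layer by (simp add: emeasure_layer_measure)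
qed

text \<open>Open boxes are fitted inside the unit ball to bound its mass from below, closed boxes
  around it to bound it from above.\<close>

lemma emeasure_coords_box:
  assumes "0 \<le> s"
  shows "emeasure (coords \<Otimes>\<^sub>M lborel) (Pi\<^sub>E {..<k} (\<lambda>_. {-s<..<s}) \<times> {-s<..<s}) = ennreal ((2 * s) ^ (k + 1))"
    "emeasure (coords \<Otimes>\<^sub>M lborel) (Pi\<^sub>E {..<k} (\<lambda>_. {-s..s}) \<times> {-s..s}) = ennreal ((2 * s) ^ (k + 1))"
proof -
  interpret product_sigma_finite "\<lambda>_::nat. lborel :: real measure" by standard
  have eq: "ennreal (2 * s) ^ k * ennreal (2 * s) = ennreal ((2 * s) ^ (k + 1))"
    using assms by (simp add: ennreal_power mult.commute flip: ennreal_mult)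
  show "emeasure (coords \<Otimes>\<^sub>M lborel) (Pi\<^sub>E {..<k} (\<lambda>_. {-s<..<s}) \<times> {-s<..<s}) = ennreal ((2 * s) ^ (k + 1))"
    unfolding eq[symmetric] using assms
    by (subst lborel.emeasure_pair_measure_Times) (auto simp: emeasure_PiM)
  show "emeasure (coords \<Otimes>\<^sub>M lborel) (Pi\<^sub>E {..<k} (\<lambda>_. {-s..s}) \<times> {-s..s}) = ennreal ((2 * s) ^ (k + 1))"
    unfolding eq[symmetric] using assms
    by (subst lborel.emeasure_pair_measure_Times) (auto simp: emeasure_PiM)
qed

end

locale metric_frame = frame b k + rotational_metric \<rho>
  for b :: "nat \<Rightarrow> (real^'n::finite) \<times> (real^'n)" and k :: nat
    and \<rho> :: "'n heis \<Rightarrow> 'n heis \<Rightarrow> real"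
begin

lemma emeasure_layer_mball_pos: "0 < emeasure layer_measure (mball 0 1)"
proof -
  obtain C where C: "C \<ge> 0" "\<And>x y t. \<rho> 0 (x, y, t) \<le> C * (norm (x, y) + sqrt \<bar>t\<bar>)"
    by (rule dist_0_le) blast
  \<comment> \<open>A box of half-width \<open>h\<^sup>2\<close> serves both directions: the
    horizontal norm is at most \<open>k * h\<close> as \<open>h \<le> 1\<close>, and the root of the
    height is at most \<open>h\<close>. The choice makes \<open>(C + 1) * (k + 1) * h\<close> equal
    to 1.\<close>
  define h where "h = 1 / ((C + 1) * (k + 1))"
  have h: "0 < h" "h \<le> 1"
  proof -
    have 1: "1 \<le> (C + 1) * real (k + 1)"
      using C(1) mult_mono[of 1 "C + 1" 1 "real (k + 1)"] by simp
    then have "0 < (C + 1) * real (k + 1)" by linarith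
    with 1 show "0 < h" "h \<le> 1"
      by (simp_all only: h_def zero_less_divide_1_iff divide_le_eq_1_pos)
  qed
  let ?Q = "Pi\<^sub>E {..<k} (\<lambda>_. {-(h\<^sup>2)<..<h\<^sup>2}) \<times> {-(h\<^sup>2)<..<h\<^sup>2}"
  let ?m = "\<lambda>x. lift (comb (fst x)) (snd x)"
  have "?Q \<subseteq> ?m -` mball 0 1 \<inter> space (coords \<Otimes>\<^sub>M lborel)"
  proof
    fix x assume x: "x \<in> ?Q"
    have xi: "\<bar>fst x i\<bar> \<le> h\<^sup>2" if "i \<in> {..<k}" for i
    proof -
      have "fst x i \<in> {-(h\<^sup>2)<..<h\<^sup>2}" using x that by (metis PiE_mem mem_Times_iff)
      then show ?thesis unfolding greaterThanLessThan_iff by linarith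
    qed
    have "snd x \<in> {-(h\<^sup>2)<..<h\<^sup>2}" using x by (metis mem_Times_iff)
    then have xt: "\<bar>snd x\<bar> \<le> h\<^sup>2" unfolding greaterThanLessThan_iff by linarith
    have "norm (comb (fst x)) \<le> (\<Sum>i<k. \<bar>fst x i\<bar>)" by (rule norm_comb_le)
    also have "\<dots> \<le> (\<Sum>i<k. h\<^sup>2)" by (rule sum_mono) (rule xi)
    also have "\<dots> = k * h\<^sup>2" by simp
    also have "\<dots> \<le> k * h" using h by (intro mult_left_mono) (auto simp: power2_eq_square)
    finally have 1: "norm (comb (fst x)) \<le> k * h" .
    have "sqrt \<bar>snd x\<bar> \<le> sqrt (h\<^sup>2)" using xt by (rule real_sqrt_le_mono)
    then have 2: "sqrt \<bar>snd x\<bar> \<le> h" using h by simp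
    have "\<rho> 0 (?m x) \<le> C * (norm (comb (fst x)) + sqrt \<bar>snd x\<bar>)"
      using C(2)[of "fst (comb (fst x))" "snd (comb (fst x))" "snd x"] by (simp add: lift_def)
    also have "\<dots> \<le> C * (k * h + h)" using 1 2 C(1) by (intro mult_left_mono add_mono)
    also have "\<dots> < (C + 1) * (k + 1) * h" using h by (simp add: algebra_simps add_pos_nonneg)
    also have "\<dots> = 1" using C(1) by (simp add: h_def)
    finally have "?m x \<in> mball 0 1" by simp
    moreover have "x \<in> space (coords \<Otimes>\<^sub>M lborel)"
      using x by (cases x) (auto simp: space_pair_measure space_PiM PiE_iff)
    ultimately show "x \<in> ?m -` mball 0 1 \<inter> space (coords \<Otimes>\<^sub>M lborel)" by simp
  qed
  then have "emeasure (coords \<Otimes>\<^sub>M lborel) ?Q \<le>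
      emeasure (coords \<Otimes>\<^sub>M lborel) (?m -` mball 0 1 \<inter> space (coords \<Otimes>\<^sub>M lborel))"
    by (intro emeasure_mono measurable_sets[OF measurable_lift_comb] borel_open open_mball)
  also have "\<dots> = emeasure layer_measure (mball 0 1)"
    unfolding layer_measure_def
    by (rule emeasure_distr[symmetric]) (auto intro: borel_open open_mball)
  finally have "ennreal ((2 * h\<^sup>2) ^ (k + 1)) \<le> emeasure layer_measure (mball 0 1)"
    by (simp only: emeasure_coords_box(1)[of "h\<^sup>2"] zero_le_power2)
  moreover have "0 < ennreal ((2 * h\<^sup>2) ^ (k + 1))" using h by (simp add: ennreal_zero_less_mult_iff)
  ultimately show ?thesis by order
qed

lemma emeasure_layer_mcball_finite: "emeasure layer_measure (mcball 0 1) < \<infinity>"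
proof -
  obtain c where c: "c > 0" "\<And>x y t. c * (norm (x, y) + sqrt \<bar>t\<bar>) \<le> \<rho> 0 (x, y, t)"
    by (rule dist_0_ge) blast
  \<comment> \<open>The first entry bounds the horizontal coordinates, the second the height, of
    which only the root is at most \<open>1 / c\<close>.\<close>
  define s where "s = max (1 / c) ((1 / c)\<^sup>2)"
  have s: "0 \<le> s" using c by (simp add: s_def le_max_iff_disj)
  let ?Q = "Pi\<^sub>E {..<k} (\<lambda>_. {-s..s}) \<times> {-s..s}"
  let ?m = "\<lambda>x. lift (comb (fst x)) (snd x)"
  have "?m -` mcball 0 1 \<inter> space (coords \<Otimes>\<^sub>M lborel) \<subseteq> ?Q"
  proof
    fix x assume x: "x \<in> ?m -` mcball 0 1 \<inter> space (coords \<Otimes>\<^sub>M lborel)"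
    then have "c * (norm (comb (fst x)) + sqrt \<bar>snd x\<bar>) \<le> 1"
      using c(2)[of "fst (comb (fst x))" "snd (comb (fst x))" "snd x"] by (simp add: lift_def)
    then have "norm (comb (fst x)) + sqrt \<bar>snd x\<bar> \<le> 1 / c" using c by (simp add: field_simps)
    then have 1: "norm (comb (fst x)) \<le> 1 / c" "sqrt \<bar>snd x\<bar> \<le> 1 / c"
      using norm_ge_zero[of "comb (fst x)"] real_sqrt_ge_zero[of "\<bar>snd x\<bar>"] by linarith+
    have "\<bar>snd x\<bar> \<le> (1 / c)\<^sup>2" using 1(2) by (rule sqrt_le_D)
    then have "\<bar>snd x\<bar> \<le> s" by (simp add: s_def le_max_iff_disj)
    moreover have "\<bar>fst x i\<bar> \<le> s" if "i < k" for i
      using abs_le_norm_comb[OF that, of "fst x"] 1(1) by (simp add: s_def le_max_iff_disj)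
    ultimately show "x \<in> ?Q" using x
      by (cases x) (auto simp: space_pair_measure space_PiM PiE_iff abs_le_iff minus_le_iff)
  qed
  moreover have "?Q \<in> sets (coords \<Otimes>\<^sub>M lborel)"
    by (intro pair_measureI sets_PiM_I_finite) auto
  ultimately have "emeasure (coords \<Otimes>\<^sub>M lborel) (?m -` mcball 0 1 \<inter> space (coords \<Otimes>\<^sub>M lborel)) \<le>
      emeasure (coords \<Otimes>\<^sub>M lborel) ?Q"
    by (rule emeasure_mono)
  also have "\<dots> < \<infinity>" using s by (simp only: emeasure_coords_box(2)) simp
  finally show ?thesis
    unfolding layer_measure_def
    by (subst emeasure_distr) (auto intro: borel_closed closed_mcball)
qed

sublocale homogeneous_haar \<rho> layer layer_measure "k + 2"
proof
  show "0 \<in> layer" using subspace_0[OF subspace_range_comb] by (simp add: layer_def)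
qed (simp_all add: borel_layer emeasure_Compl_layer emeasure_layer_mult_image_same
  emeasure_layer_dil_image emeasure_layer_mball_pos emeasure_layer_mcball_finite
  del: infinity_ennreal_def)

text \<open>Here rotational invariance enters the comparison of layers: membership of
  \<open>lift z t\<close> in a ball about 0 depends only on the norm of \<open>z\<close> and on
  \<open>t\<close>.\<close>

lemma fibre_length_ball_cong:
  assumes "norm z = norm z'"
  shows "fibre_length (mball 0 r) z = fibre_length (mball 0 r) z'"
    "fibre_length (mcball 0 r) z = fibre_length (mcball 0 r) z'"
proof -
  have "\<rho> 0 (lift z t) = \<rho> 0 (lift z' t)" for t
    unfolding lift_def by (rule dist_0_cong) (simp add: assms)
  then show "fibre_length (mball 0 r) z = fibre_length (mball 0 r) z'"
    "fibre_length (mcball 0 r) z = fibre_length (mcball 0 r) z'"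
    by (simp_all add: fibre_length_def)
qed

lemma emeasure_layer_mcball:
  "emeasure layer_measure (mcball q r) =
    (\<integral>\<^sup>+c. fibre_length (mcball 0 r) (comb c - horizontal_part q) \<partial>coords)"
  using mcball_image[of 1 q 0 r] emeasure_layer_mult_image[of "mcball 0 r" q] by simp

end

section \<open>Comparing layers of equal dimension\<close>

context frame
begin

text \<open>Pythagoras. The right-hand side contains the coordinates and the length of
  \<open>v\<close> but not the frame, so it can be matched across two frames.\<close>

lemma norm_comb_diff:
  assumes v: "\<And>i. i < k \<Longrightarrow> v \<bullet> b i = 0"
  shows "(norm (comb c - (comb a + v)))\<^sup>2 = (\<Sum>i<k. (c i - a i)\<^sup>2) + (norm v)\<^sup>2"
proof -
  let ?x = "\<lambda>i. c i - a i"
  have "comb c - (comb a + v) = comb ?x - v"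
    by (simp add: comb_def algebra_simps sum_subtractf)
  then have "(norm (comb c - (comb a + v)))\<^sup>2 = (comb ?x - v) \<bullet> (comb ?x - v)"
    by (simp only: power2_norm_eq_inner)
  moreover have "comb ?x \<bullet> v = 0"
    unfolding comb_def inner_sum_left using v by (simp add: inner_commute)
  ultimately have "(norm (comb c - (comb a + v)))\<^sup>2 = comb ?x \<bullet> comb ?x + v \<bullet> v"
    by (simp add: inner_diff_left inner_diff_right inner_commute)
  moreover have "v \<bullet> v = (norm v)\<^sup>2" by (simp add: power2_norm_eq_inner)
  ultimately show ?thesis by (simp add: inner_comb flip: power2_eq_square)
qed

lemma orthogonal_decomposition:
  obtains a v where "z = comb a + v" "\<And>i. i < k \<Longrightarrow> v \<bullet> b i = 0"
proof
  show "z = comb (\<lambda>i. z \<bullet> b i) + (z - comb (\<lambda>i. z \<bullet> b i))" by simp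
  show "(z - comb (\<lambda>i. z \<bullet> b i)) \<bullet> b i = 0" if "i < k" for i
    using inner_comb_b[OF that] by (simp add: inner_diff_left)
qed

text \<open>Since \<open>k\<close> is below the dimension of \<open>\<real>\<^sup>2\<^sup>n\<close>,
  some nonzero vector is orthogonal to the frame and can be rescaled to any length.\<close>

lemma orthogonal_vector_exists:
  assumes "k < 2 * CARD('n)" "0 \<le> s"
  obtains v where "norm v = s" "\<And>i. i < k \<Longrightarrow> v \<bullet> b i = 0"
proof -
  have "dim (b ` {..<k}) \<le> card (b ` {..<k})" by (rule dim_le_card[OF span_superset]) simp
  also have "\<dots> \<le> k" using card_image_le[of "{..<k}" b] by simp
  finally have "dim (b ` {..<k}) < DIM((real^'n) \<times> (real^'n))" using assms by simp
  then obtain x where x: "x \<noteq> 0" "\<And>y. y \<in> span (b ` {..<k}) \<Longrightarrow> orthogonal x y"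
    using orthogonal_to_subspace_exists by blast
  have "x \<bullet> b i = 0" if "i < k" for i
    using x(2)[of "b i"] that by (simp add: orthogonal_def span_base)
  then show thesis using x(1) assms(2) by (intro that[of "(s / norm x) *\<^sub>R x"]) simp_all
qed

end

text \<open>The new centre has the same coordinates along the second frame and an orthogonal part of
  the same length. The two fibre integrands then agree for every coordinate vector
  \<open>c\<close>.\<close>

lemma emeasure_layer_mcball_transfer:
  assumes "metric_frame b k \<rho>" "metric_frame b' k \<rho>" "k < 2 * CARD('n)"
  fixes q :: "'n::finite heis"
  shows "\<exists>q'. \<forall>r. emeasure (frame.layer_measure b k) (Metric_space.mcball UNIV \<rho> q r) =
    emeasure (frame.layer_measure b' k) (Metric_space.mcball UNIV \<rho> q' r)"
proof -
  interpret f: metric_frame b k \<rho> by fact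
  interpret f': metric_frame b' k \<rho> by fact
  obtain a v where av: "horizontal_part q = f.comb a + v" "\<And>i. i < k \<Longrightarrow> v \<bullet> b i = 0"
    using f.orthogonal_decomposition by blast
  obtain v' where v': "norm v' = norm v" "\<And>i. i < k \<Longrightarrow> v' \<bullet> b' i = 0"
    using f'.orthogonal_vector_exists[OF assms(3) norm_ge_zero] by blast
  \<comment> \<open>The height 0 is an arbitrary choice: the mass of a ball depends only on the
    horizontal part of its centre.\<close>
  let ?q' = "lift (f'.comb a + v') 0"
  have "(norm (f.comb c - horizontal_part q))\<^sup>2 = (norm (f'.comb c - horizontal_part ?q'))\<^sup>2" for c
    using f.norm_comb_diff[OF av(2)] f'.norm_comb_diff[OF v'(2)] av(1) v'(1) by simp
  then have "norm (f.comb c - horizontal_part q) = norm (f'.comb c - horizontal_part ?q')" for c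
    by (simp add: power2_eq_iff_nonneg)
  then have "fibre_length (f.mcball 0 r) (f.comb c - horizontal_part q) =
      fibre_length (f.mcball 0 r) (f'.comb c - horizontal_part ?q')" for c r
    by (rule f.fibre_length_ball_cong(2))
  then have "emeasure f.layer_measure (f.mcball q r) = emeasure f'.layer_measure (f.mcball ?q' r)" for r
    by (simp only: f.emeasure_layer_mcball f'.emeasure_layer_mcball)
  then show ?thesis by blast
qed

lemma (in metric_frame) spherical_measure_layer:
  assumes "0 < r"
  shows "spherical_measure \<rho> (k + 2) (layer \<inter> mball 0 r) =
    ennreal (2 ^ (k + 2) / max_mass * measure layer_measure (mball 0 r))"
proof -
  have "relatively_open (mball 0 r \<inter> layer)"
    unfolding relatively_open_def
  proof (intro conjI ballI)
    fix x assume x: "x \<in> mball 0 r \<inter> layer"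
    have "mball x (r - \<rho> 0 x) \<subseteq> mball 0 r"
    proof
      fix p assume "p \<in> mball x (r - \<rho> 0 x)"
      then show "p \<in> mball 0 r" using triangle[of 0 x p] by simp
    qed
    then show "\<exists>s>0. mball x s \<inter> layer \<subseteq> mball 0 r \<inter> layer"
      using x by (intro exI[of _ "r - \<rho> 0 x"]) auto
  qed (use borel_mball borel_layer in auto)
  moreover have "emeasure layer_measure (mball 0 r \<inter> layer) < \<infinity>"
    using assms by (simp add: emeasure_Int_P emeasure_mball zero_in emeasure_unit
        ennreal_mult_less_top)
  moreover have "measure layer_measure (mball 0 r \<inter> layer) = measure layer_measure (mball 0 r)"
    by (simp add: measure_def emeasure_Int_P)
  ultimately show ?thesis
    using spherical_measure_eq[of "mball 0 r \<inter> layer"] by (simp only: Int_commute)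
qed

text \<open>In the formula for the spherical measure only \<open>max_mass\<close> and the mass of
  the central ball depend on the frame. Transferring centres in both directions shows that the two
  suprema run over the same set of values.\<close>

theorem spherical_measure_layer_eq:
  fixes \<rho> :: "'n::finite heis \<Rightarrow> 'n heis \<Rightarrow> real"
  assumes "metric_frame b k \<rho>" "metric_frame b' k \<rho>" "k < 2 * CARD('n)" "0 < r"
  shows "spherical_measure \<rho> (k + 2) (frame.layer b k \<inter> Metric_space.mball UNIV \<rho> 0 r) =
    spherical_measure \<rho> (k + 2) (frame.layer b' k \<inter> Metric_space.mball UNIV \<rho> 0 r)"
proof -
  interpret f: metric_frame b k \<rho> by fact
  interpret f': metric_frame b' k \<rho> by fact
  have "range (\<lambda>q. measure f.layer_measure (f.mcball q 1)) =
      range (\<lambda>q. measure f'.layer_measure (f.mcball q 1))"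
  proof (intro equalityI image_subsetI)
    fix q
    obtain q' where "\<forall>r. emeasure f.layer_measure (f.mcball q r) = emeasure f'.layer_measure (f.mcball q' r)"
      using emeasure_layer_mcball_transfer[OF assms(1-3), of q] by blast
    then show "measure f.layer_measure (f.mcball q 1) \<in> range (\<lambda>q. measure f'.layer_measure (f.mcball q 1))"
      unfolding measure_def by (intro range_eqI[of _ _ q']) simp
    obtain q' where "\<forall>r. emeasure f'.layer_measure (f.mcball q r) = emeasure f.layer_measure (f.mcball q' r)"
      using emeasure_layer_mcball_transfer[OF assms(2,1,3), of q] by blast
    then show "measure f'.layer_measure (f.mcball q 1) \<in> range (\<lambda>q. measure f.layer_measure (f.mcball q 1))"
      unfolding measure_def by (intro range_eqI[of _ _ q']) simp
  qed
  then have max: "f.max_mass = f'.max_mass" by (simp add: f.max_mass_def f'.max_mass_def)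
  \<comment> \<open>Both combinations have the Euclidean norm of the coordinate vector, so the
    fibres over them have equal length.\<close>
  have ball: "emeasure f.layer_measure (f.mball 0 r) = emeasure f'.layer_measure (f.mball 0 r)"
  proof -
    have "norm (f.comb c) = norm (f'.comb c)" for c
      by (simp add: norm_eq_sqrt_inner f.inner_comb f'.inner_comb)
    then have "fibre_length (f.mball 0 r) (f.comb c) = fibre_length (f.mball 0 r) (f'.comb c)" for c
      by (rule f.fibre_length_ball_cong(1))
    then show ?thesis by (simp add: f.emeasure_layer_measure f'.emeasure_layer_measure)
  qed
  show ?thesis
    unfolding f.spherical_measure_layer[OF \<open>0 < r\<close>] f'.spherical_measure_layer[OF \<open>0 < r\<close>] max
    using ball by (simp add: measure_def)
qed

section \<open>Unitary isometries\<close>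

text \<open>\<open>rot z \<bullet> z'\<close> is the symplectic form of the group law, so orthogonal
  maps commuting with \<open>rot\<close> act as automorphisms of the group.\<close>

definition rot :: "(real^'n::finite) \<times> (real^'n) \<Rightarrow> (real^'n) \<times> (real^'n)" where
  "rot z = (- snd z, fst z)"

lemma heis_mult_lift: "heis_mult (lift z s) (lift z' s') = lift (z + z') (s + s' + (rot z \<bullet> z') / 2)"
  by (cases z; cases z') (simp add: lift_def heis_mult_Pair rot_def inner_commute)

lemma rot_simps [simp]:
  "rot (x + y) = rot x + rot y" "rot (x - y) = rot x - rot y" "rot (c *\<^sub>R x) = c *\<^sub>R rot x"
  "rot (rot x) = - x" "rot x \<bullet> rot y = x \<bullet> y" "x \<bullet> rot x = 0" "rot x \<bullet> x = 0"
  by (cases x; cases y; simp add: rot_def inner_commute)+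

lemma inner_rot: "x \<bullet> rot y = - (rot x \<bullet> y)"
  by (cases x; cases y) (simp add: rot_def inner_commute)

text \<open>With \<open>rot\<close> as multiplication by \<open>\<i>\<close>, this is the complex reflection
  \<open>z \<mapsto> z - (\<langle>z, p\<rangle> / \<langle>u, p\<rangle>) p\<close> where \<open>p = u - v\<close>.\<close>

lemma unitary_map_exists:
  fixes u v :: "(real^'n::finite) \<times> (real^'n)"
  assumes "norm u = norm v"
  obtains U where "orthogonal_transformation U" "\<And>z. U (rot z) = rot (U z)" "U u = v"
proof (cases "u = v")
  case True
  then show thesis by (intro that[of "\<lambda>z. z"]) (simp_all add: orthogonal_transformation)
next
  case False
  define p where "p = u - v"
  \<comment> \<open>\<open>\<sigma>\<close> and \<open>\<tau>\<close> are the real and imaginary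
    parts of the Hermitian product of \<open>u\<close> and \<open>p\<close>, and \<open>D\<close> is
    its squared modulus. Below, \<open>\<alpha> z\<close> and \<open>\<beta> z\<close> are the real
    and imaginary parts of the quotient in the reflection formula.\<close>
  define \<sigma> where "\<sigma> = u \<bullet> p"
  define \<tau> where "\<tau> = u \<bullet> rot p"
  define D where "D = \<sigma>\<^sup>2 + \<tau>\<^sup>2"
  define \<alpha> where "\<alpha> z = (\<sigma> * (z \<bullet> p) + \<tau> * (z \<bullet> rot p)) / D" for z
  define \<beta> where "\<beta> z = (\<sigma> * (z \<bullet> rot p) - \<tau> * (z \<bullet> p)) / D" for z
  define U where "U z = z - \<alpha> z *\<^sub>R p - \<beta> z *\<^sub>R rot p" for z
  \<comment> \<open>Equal norms give \<open>p \<bullet> p = 2 * \<sigma>\<close>. This makes the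
    denominator nonzero and is the identity by which the reflection preserves norms.\<close>
  have "u \<bullet> u = v \<bullet> v" using assms by (simp add: norm_eq)
  then have pp: "p \<bullet> p = 2 * \<sigma>" by (simp add: p_def \<sigma>_def inner_diff inner_commute)
  moreover have "p \<noteq> 0" using False by (simp add: p_def)
  ultimately have "\<sigma> > 0" using inner_gt_zero_iff[of p] by simp
  then have D: "D > 0" by (simp add: D_def add_pos_nonneg)
  have "\<alpha> (x + y) = \<alpha> x + \<alpha> y" "\<beta> (x + y) = \<beta> x + \<beta> y"
    "\<alpha> (c *\<^sub>R x) = c * \<alpha> x" "\<beta> (c *\<^sub>R x) = c * \<beta> x" for x y c
    using D by (simp_all add: \<alpha>_def \<beta>_def inner_add_left field_simps)
  then have lin: "linear U"
    by (intro linearI) (simp_all add: U_def algebra_simps)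
  have norm: "norm (U z) = norm z" for z
  proof -
    define A where "A = z \<bullet> p"
    define B where "B = z \<bullet> rot p"
    have \<alpha>\<beta>: "\<alpha> z * D = \<sigma> * A + \<tau> * B" "\<beta> z * D = \<sigma> * B - \<tau> * A"
      using D by (simp_all add: \<alpha>_def \<beta>_def A_def B_def)
    have "((\<alpha> z)\<^sup>2 + (\<beta> z)\<^sup>2) * D * D = (\<alpha> z * D)\<^sup>2 + (\<beta> z * D)\<^sup>2"
      by (simp add: power2_eq_square algebra_simps)
    also have "\<dots> = (\<sigma> * A + \<tau> * B)\<^sup>2 + (\<sigma> * B - \<tau> * A)\<^sup>2" by (simp only: \<alpha>\<beta>)
    also have "\<dots> = (A\<^sup>2 + B\<^sup>2) * D" by (simp add: D_def power2_eq_square algebra_simps)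
    finally have 1: "((\<alpha> z)\<^sup>2 + (\<beta> z)\<^sup>2) * D = A\<^sup>2 + B\<^sup>2" using D by simp
    have "(\<alpha> z * A + \<beta> z * B) * D = (\<alpha> z * D) * A + (\<beta> z * D) * B" by (simp add: algebra_simps)
    also have "\<dots> = \<sigma> * (A\<^sup>2 + B\<^sup>2)"
      unfolding \<alpha>\<beta> by (simp add: power2_eq_square algebra_simps)
    also have "\<dots> = \<sigma> * ((\<alpha> z)\<^sup>2 + (\<beta> z)\<^sup>2) * D" by (simp add: 1[symmetric])
    finally have 2: "\<alpha> z * A + \<beta> z * B = \<sigma> * ((\<alpha> z)\<^sup>2 + (\<beta> z)\<^sup>2)" using D by simp
    \<comment> \<open>\<open>p\<close> and \<open>rot p\<close> are orthogonal of equal length, so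
      no mixed term survives; the two correction terms cancel by the preceding identity.\<close>
    have "U z \<bullet> U z = z \<bullet> z - 2 * (\<alpha> z * A + \<beta> z * B) + ((\<alpha> z)\<^sup>2 + (\<beta> z)\<^sup>2) * (2 * \<sigma>)"
      unfolding pp[symmetric] U_def A_def B_def
      by (simp add: inner_diff inner_commute power2_eq_square algebra_simps)
    then have "U z \<bullet> U z = z \<bullet> z" by (simp add: 2)
    then show ?thesis by (simp add: norm_eq)
  qed
  \<comment> \<open>Multiplying \<open>z\<close> by the imaginary unit multiplies the quotient by it
    too, which is complex linearity in real coordinates.\<close>
  have "\<alpha> (rot z) = - \<beta> z" "\<beta> (rot z) = \<alpha> z" for z
    using D by (simp_all add: \<alpha>_def \<beta>_def inner_rot field_simps)
  then have comm: "U (rot z) = rot (U z)" for z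
    by (simp add: U_def algebra_simps)
  have "\<alpha> u = D / D" "\<beta> u = 0"
    by (simp_all add: \<alpha>_def \<beta>_def D_def power2_eq_square flip: \<sigma>_def \<tau>_def)
  then have "\<alpha> u = 1" "\<beta> u = 0" using D by simp_all
  then have "U u = v" by (simp add: U_def p_def)
  moreover have "orthogonal_transformation U" using lin norm by (simp add: orthogonal_transformation)
  ultimately show thesis using comm by (intro that[of U])
qed

section \<open>Hausdorff measure under isometries\<close>

lemma diam_image_isometry_le:
  assumes "\<And>x y. \<rho> (f x) (f y) = \<rho> x y"
  shows "diam \<rho> (f ` E) \<le> diam \<rho> E"
  unfolding diam_def
proof (rule SUP_least)
  fix z assume "z \<in> f ` E \<times> f ` E"
  then obtain x y where "(x, y) \<in> E \<times> E" "z = (f x, f y)" by blast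
  then show "(case z of (p, q) \<Rightarrow> ennreal (\<rho> p q)) \<le> (SUP (p, q)\<in>E \<times> E. ennreal (\<rho> p q))"
    using assms by (intro SUP_upper2[of "(x, y)"]) auto
qed

lemma hausdorff_measure_image_isometry_le:
  assumes "\<And>x y. \<rho> (f x) (f y) = \<rho> x y"
  shows "hausdorff_measure \<rho> d (f ` E) \<le> hausdorff_measure \<rho> d E"
  unfolding hausdorff_measure_eq_SUP
proof (rule SUP_mono')
  fix \<epsilon>
  show "hausdorff_premeasure \<rho> d \<epsilon> (f ` E) \<le> hausdorff_premeasure \<rho> d \<epsilon> E"
    unfolding hausdorff_premeasure_def
  proof (rule Inf_mono)
    fix s assume "s \<in> {\<Sum>j. diam \<rho> (F j) ^ d | F :: nat \<Rightarrow> 'a set.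
        E \<subseteq> (\<Union>j. F j) \<and> (\<forall>j. diam \<rho> (F j) < ennreal \<epsilon>)}"
    then obtain F :: "nat \<Rightarrow> 'a set" where F: "s = (\<Sum>j. diam \<rho> (F j) ^ d)" "E \<subseteq> (\<Union>j. F j)"
      "\<And>j. diam \<rho> (F j) < ennreal \<epsilon>" by blast
    have le: "diam \<rho> (f ` F j) \<le> diam \<rho> (F j)" for j
      by (rule diam_image_isometry_le) (rule assms)
    have "(\<Sum>j. diam \<rho> (f ` F j) ^ d) \<le> s"
      unfolding F(1) by (intro suminf_le power_mono le) auto
    moreover have "f ` E \<subseteq> (\<Union>j. f ` F j)" using F(2) by blast
    moreover have "diam \<rho> (f ` F j) < ennreal \<epsilon>" for j using le[of j] F(3)[of j] by order
    ultimately show "\<exists>a\<in>{\<Sum>j. diam \<rho> (F j) ^ d | F :: nat \<Rightarrow> 'a set.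
        f ` E \<subseteq> (\<Union>j. F j) \<and> (\<forall>j. diam \<rho> (F j) < ennreal \<epsilon>)}. a \<le> s"
      by (intro bexI[of _ "\<Sum>j. diam \<rho> (f ` F j) ^ d"] CollectI exI[of _ "\<lambda>j. f ` F j"]) auto
  qed
qed

lemma hausdorff_measure_mono:
  "E \<subseteq> F \<Longrightarrow> hausdorff_measure \<rho> d E \<le> hausdorff_measure \<rho> d F"
  unfolding hausdorff_measure_eq_SUP hausdorff_premeasure_def
  by (intro SUP_mono' Inf_superset_mono) blast

text \<open>A unitary map preserves the symplectic form, so applying it horizontally is a group
  morphism. It keeps the horizontal norm and the height, hence the distance to 0, and left
  invariance reduces all distances to that case.\<close>

lemma (in rotational_metric) unitary_isometry:
  assumes U: "orthogonal_transformation U" "\<And>z. U (rot z) = rot (U z)"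
  shows "\<rho> (lift (U (horizontal_part p)) (snd (snd p))) (lift (U (horizontal_part q)) (snd (snd q))) = \<rho> p q"
proof -
  define \<Phi> where "\<Phi> p = lift (U (horizontal_part p)) (snd (snd p))" for p
  have linear: "linear U" and inner: "\<And>z w. U z \<bullet> U w = z \<bullet> w"
    using U by (auto simp: orthogonal_transformation_def)
  have mult: "\<Phi> (heis_mult (lift z s) (lift z' s')) = heis_mult (\<Phi> (lift z s)) (\<Phi> (lift z' s'))" for z z' s s'
    using linear_add[OF linear] inner U(2)[of z, symmetric]
    by (simp add: \<Phi>_def heis_mult_lift) (simp add: lift_def)
  have minus: "- lift z s = lift (- z) (- s)" for z :: "(real^'n) \<times> (real^'n)" and s
    by (simp add: lift_def)
  have \<Phi>0: "\<rho> 0 (\<Phi> p) = \<rho> 0 p" for p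
  proof -
    have "\<rho> 0 (\<Phi> p) = \<rho> 0 (lift (horizontal_part p) (snd (snd p)))"
      unfolding \<Phi>_def lift_def
      by (intro dist_0_cong) (simp add: orthogonal_transformation_norm[OF U(1)])
    then show ?thesis by simp
  qed
  have "\<rho> (\<Phi> p) (\<Phi> q) = \<rho> 0 (heis_mult (- \<Phi> p) (\<Phi> q))" by (rule dist_eq)
  also have "heis_mult (- \<Phi> p) (\<Phi> q) = \<Phi> (heis_mult (- p) q)"
  proof -
    have "- \<Phi> p = \<Phi> (- p)" unfolding \<Phi>_def using linear_neg[OF linear]
      by (simp add: minus)
    moreover have "\<Phi> (heis_mult p' q) = heis_mult (\<Phi> p') (\<Phi> q)" for p'
      using mult[of "horizontal_part p'" "snd (snd p')" "horizontal_part q" "snd (snd q)"] by simp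
    ultimately show ?thesis by simp
  qed
  also have "\<rho> 0 \<dots> = \<rho> p q" unfolding \<Phi>0 by (rule dist_eq[symmetric])
  finally show ?thesis by (simp only: \<Phi>_def)
qed

text \<open>A unitary map taking \<open>u\<close> to \<open>v\<close> sends one hyperplane onto the
  other and fixes 0, so it respects balls about 0. The assumption is symmetric in \<open>u\<close>
  and \<open>v\<close>, which supplies the reverse inequality.\<close>

lemma (in rotational_metric) hausdorff_measure_hyperplane_le:
  fixes u v :: "(real^'n) \<times> (real^'n)"
  assumes "norm u = norm v"
  shows "hausdorff_measure \<rho> d ({p. v \<bullet> horizontal_part p = 0} \<inter> mball 0 r) \<le>
    hausdorff_measure \<rho> d ({p. u \<bullet> horizontal_part p = 0} \<inter> mball 0 r)"
proof -
  obtain U where U: "orthogonal_transformation U" "\<And>z. U (rot z) = rot (U z)" "U u = v"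
    using unitary_map_exists[OF assms] by blast
  define \<Phi> where "\<Phi> p = lift (U (horizontal_part p)) (snd (snd p))" for p
  have iso: "\<rho> (\<Phi> p) (\<Phi> q) = \<rho> p q" for p q
    unfolding \<Phi>_def by (rule unitary_isometry[OF U(1,2)])
  have "\<Phi> 0 = 0"
  proof -
    have "U 0 = 0" using orthogonal_transformation_linear[OF U(1)] by (rule linear_0)
    then show ?thesis unfolding \<Phi>_def horizontal_part_simps by (simp add: lift_def zero_prod_def)
  qed
  have "{p. v \<bullet> horizontal_part p = 0} \<inter> mball 0 r \<subseteq> \<Phi> ` ({p. u \<bullet> horizontal_part p = 0} \<inter> mball 0 r)"
  proof
    fix p assume p: "p \<in> {p. v \<bullet> horizontal_part p = 0} \<inter> mball 0 r"
    obtain z where z: "U z = horizontal_part p"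
      using orthogonal_transformation_surj[OF U(1)] by (metis surj_def)
    let ?q = "lift z (snd (snd p))"
    have \<Phi>q: "\<Phi> ?q = p" by (simp add: \<Phi>_def z) (simp add: lift_def horizontal_part_def)
    have "\<rho> 0 ?q = \<rho> 0 p" using iso[of 0 ?q] by (simp add: \<Phi>q \<open>\<Phi> 0 = 0\<close>)
    moreover have "u \<bullet> z = v \<bullet> horizontal_part p"
      using U(1,3) z unfolding orthogonal_transformation_def by metis
    ultimately have "?q \<in> {p. u \<bullet> horizontal_part p = 0} \<inter> mball 0 r" using p by simp
    then show "p \<in> \<Phi> ` ({p. u \<bullet> horizontal_part p = 0} \<inter> mball 0 r)" using \<Phi>q by (metis image_eqI)
  qed
  then have "hausdorff_measure \<rho> d ({p. v \<bullet> horizontal_part p = 0} \<inter> mball 0 r) \<le>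
      hausdorff_measure \<rho> d (\<Phi> ` ({p. u \<bullet> horizontal_part p = 0} \<inter> mball 0 r))"
    by (rule hausdorff_measure_mono)
  also have "\<dots> \<le> hausdorff_measure \<rho> d ({p. u \<bullet> horizontal_part p = 0} \<inter> mball 0 r)"
    by (rule hausdorff_measure_image_isometry_le) (rule iso)
  finally show ?thesis .
qed

section \<open>Tangent subgroups\<close>

text \<open>Rank-nullity: \<open>l\<close> maps the orthogonal complement of its kernel bijectively
  onto the target.\<close>

lemma dim_linear_kernel:
  fixes l :: "'a::euclidean_space \<Rightarrow> 'b::euclidean_space"
  assumes l: "linear l" "surj l"
  shows "dim {z. l z = 0} + DIM('b) = DIM('a)"
proof -
  let ?W = "{z. l z = 0}"
  let ?V = "{y \<in> UNIV. \<forall>x\<in>?W. orthogonal x y}"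
  have W: "subspace ?W" using l(1) by (rule linear_subspace_kernel)
  have V: "subspace ?V"
    by (auto simp: subspace_def orthogonal_def inner_add_right)
  have "inj_on l ?V"
  proof (rule inj_onI)
    fix x y assume xy: "x \<in> ?V" "y \<in> ?V" "l x = l y"
    then have "x - y \<in> ?W" using linear_diff[OF l(1)] by simp
    moreover have "x - y \<in> ?V" using V xy by (intro subspace_diff)
    ultimately have "orthogonal (x - y) (x - y)" by blast
    then show "x = y" by (simp add: orthogonal_def)
  qed
  then have "dim (l ` ?V) = dim ?V"
    using l(1) V by (intro dim_image_eq) (simp_all add: span_eq_iff[THEN iffD2] del: mem_Collect_eq)
  moreover have "l ` ?V = UNIV"
  proof (intro equalityI subsetI UNIV_I)
    fix y
    obtain x where x: "l x = y" using l(2) by (metis surj_def)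
    obtain w v where wv: "w \<in> span ?W" "\<And>a. a \<in> span ?W \<Longrightarrow> orthogonal v a" "x = w + v"
      using orthogonal_subspace_decomp_exists[of ?W x] by blast
    have "w \<in> ?W" using wv(1) W by (simp add: span_eq_iff[THEN iffD2] del: mem_Collect_eq)
    then have lv: "y = l v" using x wv(3) linear_add[OF l(1)] by simp
    have "orthogonal a v" if "a \<in> ?W" for a
      using wv(2)[OF span_base[OF that]] by (simp add: orthogonal_commute)
    then have "v \<in> ?V" by simp
    with lv show "y \<in> l ` ?V" by (rule image_eqI)
  qed
  ultimately have "dim ?V = DIM('b)" by simp
  then show ?thesis using dim_subspace_orthogonal_to_vectors[OF W subspace_UNIV] by simp
qed

lemma homogeneous_morphism_mult:
  "homogeneous_morphism L \<Longrightarrow> L (heis_mult p q) = L p + L q"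
  by (simp add: homogeneous_morphism_def hom_def vec_group_def del: split_paired_All)

lemma homogeneous_morphism_dil:
  "homogeneous_morphism L \<Longrightarrow> 0 < c \<Longrightarrow> L (dil c p) = c *\<^sub>R L p"
  unfolding homogeneous_morphism_def by blast

lemma kernel_heis: "kernel heis_group vec_group L = {p. L p = 0}"
  by (simp add: kernel_def vec_group_def)

text \<open>Dilation by 2 multiplies a height by 4, so on vertical elements homogeneity gives twice
  the value of \<open>L\<close> and additivity four times; hence \<open>L\<close> vanishes there.
  Homogeneity covers positive scalars only, and negative ones come from additivity.\<close>

lemma homogeneous_morphism_horizontal:
  fixes L :: "'n::finite heis \<Rightarrow> real^'m::finite"
  assumes L: "homogeneous_morphism L"
  obtains l where "linear l" "\<And>p. L p = l (horizontal_part p)"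
proof -
  note mult = homogeneous_morphism_mult[OF L] and dil = homogeneous_morphism_dil[OF L]
  have vertical: "L (lift 0 t) = 0" for t
  proof -
    have add: "heis_mult (lift 0 s) (lift 0 s') = (lift 0 (s + s') :: 'n heis)" for s s'
      by (simp add: heis_mult_lift rot_def)
    have "2 *\<^sub>R L (lift 0 t) = L (lift 0 (4 * t))"
      using dil[of 2 "lift 0 t"] by (simp add: dil_lift)
    also have "lift 0 (4 * t) = (heis_mult (heis_mult (lift 0 t) (lift 0 t)) (heis_mult (lift 0 t) (lift 0 t)) :: 'n heis)"
      by (simp add: add)
    also have "L \<dots> = 4 *\<^sub>R L (lift 0 t)" by (simp add: mult flip: scaleR_2)
    finally show ?thesis by simp
  qed
  have L_lift: "L (lift z t) = L (lift z 0)" for z t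
    using mult[of "lift z 0" "lift 0 t"] by (simp add: heis_mult_lift vertical rot_def)
  have L_add: "L (lift (z + z') 0) = L (lift z 0) + L (lift z' 0)" for z z'
    using mult[of "lift z 0" "lift z' 0"] L_lift[of "z + z'" "rot z \<bullet> z' / 2"]
    by (simp add: heis_mult_lift)
  have L_pos: "L (lift (c *\<^sub>R z) 0) = c *\<^sub>R L (lift z 0)" if "0 < c" for c z
    using dil[OF that, of "lift z 0"] by (simp add: dil_lift)
  have L_minus: "L (lift (- z) 0) = - L (lift z 0)" for z
    using L_add[of z "- z"] vertical[of 0] by (simp add: eq_neg_iff_add_eq_0 add.commute)
  show thesis
  proof (rule that[of "\<lambda>z. L (lift z 0)"])
    show "linear (\<lambda>z. L (lift z 0))"
    proof (rule linearI)
      fix c :: real and z :: "(real^'n) \<times> (real^'n)"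
      consider "0 < c" | "c = 0" | "0 < - c" by linarith
      then show "L (lift (c *\<^sub>R z) 0) = c *\<^sub>R L (lift z 0)"
      proof cases
        case 3
        then show ?thesis using L_pos[of "- c" z] L_minus[of "c *\<^sub>R z"] by simp
      qed (simp_all add: L_pos vertical)
    qed (rule L_add)
    show "L p = L (lift (horizontal_part p) 0)" for p
      using L_lift[of "horizontal_part p" "snd (snd p)"] by simp
  qed
qed

lemma tangent_subgroupE:
  fixes P :: "'n::finite heis set"
  assumes "P \<in> tangent_subgroups TYPE('m::finite)"
  obtains L :: "'n heis \<Rightarrow> real^'m" and l where "homogeneous_morphism L" "surj L" "P = {p. L p = 0}"
    "\<exists>V. complementary P V" "linear l" "surj l" "\<And>p. L p = l (horizontal_part p)"
proof -
  have "(\<exists>V. complementary P V) \<and> (\<exists>L :: 'n heis \<Rightarrow> real^'m. homogeneous_morphism L \<and> surj L \<and>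
      P = kernel heis_group vec_group L)"
    using assms unfolding tangent_subgroups_def by blast
  then obtain L :: "'n heis \<Rightarrow> real^'m" where L: "homogeneous_morphism L" "surj L"
    "P = {p. L p = 0}" "\<exists>V. complementary P V"
    unfolding kernel_heis by blast
  obtain l where l: "linear l" "\<And>p. L p = l (horizontal_part p)"
    by (rule homogeneous_morphism_horizontal[OF L(1)]) blast
  have "surj l"
    unfolding surj_def
  proof
    fix y
    obtain p where "y = L p" using L(2) unfolding surj_def by blast
    then show "\<exists>z. y = l z" using l(2) by blast
  qed
  from L l(1) this l(2) show thesis by (rule that)
qed

text \<open>The frame is an orthonormal basis of the kernel of the linear map \<open>l\<close>,
  whose dimension is \<open>k\<close> by rank-nullity.\<close>

lemma tangent_subgroup_layer:
  fixes P :: "'n::finite heis set"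
  assumes "P \<in> tangent_subgroups TYPE('m::finite)" and k: "k + CARD('m) = 2 * CARD('n)"
  obtains b where "frame b k" "P = frame.layer b k"
proof -
  obtain L :: "'n heis \<Rightarrow> real^'m" and l where L: "P = {p. L p = 0}"
    and l: "linear l" "surj l" "\<And>p. L p = l (horizontal_part p)"
    by (rule tangent_subgroupE[OF assms(1)]) blast
  let ?W = "{z. l z = 0}"
  have W: "subspace ?W" using l(1) by (rule linear_subspace_kernel)
  have "dim ?W = k" using dim_linear_kernel[OF l(1,2)] k by simp
  then obtain B where B: "pairwise orthogonal B" "\<And>x. x \<in> B \<Longrightarrow> norm x = 1"
    "independent B" "card B = k" "span B = ?W"
    using orthonormal_basis_subspace[OF W] by metis
  have "finite B" using B(3) by (rule independent_imp_finite)
  then obtain b where b: "bij_betw b {..<k} B"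
    using ex_bij_betw_nat_finite[of B] B(4) by (metis atLeast0LessThan)
  have inj: "b i = b j \<longleftrightarrow> i = j" if "i < k" "j < k" for i j
    using b that by (auto simp: bij_betw_def inj_on_def)
  have bB: "b i \<in> B" if "i < k" for i using b that by (auto simp: bij_betw_def)
  have frame: "frame b k"
  proof
    fix i j assume ij: "i < k" "j < k"
    show "b i \<bullet> b j = (if i = j then 1 else 0)"
    proof (cases "i = j")
      case True
      then show ?thesis using B(2)[OF bB[OF ij(1)]] by (simp add: norm_eq_1)
    next
      case False
      then have "orthogonal (b i) (b j)"
        using B(1) bB ij inj unfolding pairwise_def by metis
      with False show ?thesis by (simp add: orthogonal_def)
    qed
  qed
  interpret frame b k by fact
  have "range comb = span B"
  proof
    show "range comb \<subseteq> span B"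
    proof (rule image_subsetI)
      fix c show "comb c \<in> span B"
        unfolding comb_def by (intro span_sum span_scale span_base bB) simp
    qed
    have "B \<subseteq> range comb"
    proof
      fix x assume "x \<in> B"
      then obtain j where j: "j < k" "x = b j" using b by (auto simp: bij_betw_def)
      have "comb (\<lambda>i. if i = j then 1 else 0) = (\<Sum>i<k. if i = j then b i else 0)"
        unfolding comb_def by (intro sum.cong) auto
      also have "\<dots> = x" using j by simp
      finally show "x \<in> range comb" by (metis rangeI)
    qed
    then show "span B \<subseteq> range comb" by (rule span_minimal) (rule subspace_range_comb)
  qed
  then have "layer = P" by (simp add: layer_def B(5) L l(3))
  with frame show thesis by (intro that) auto
qed

lemma tangent_subgroup_hyperplane:
  fixes P :: "'n::finite heis set"
  assumes "P \<in> tangent_subgroups TYPE('m::finite)" and "CARD('m) = 1"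
  obtains u where "norm u = 1" "P = {p. u \<bullet> horizontal_part p = 0}"
proof -
  obtain L :: "'n heis \<Rightarrow> real^'m" and l where L: "P = {p. L p = 0}"
    and l: "linear l" "surj l" "\<And>p. L p = l (horizontal_part p)"
    by (rule tangent_subgroupE[OF assms(1)]) blast
  let ?W = "{z. l z = 0}"
  have W: "subspace ?W" using l(1) by (rule linear_subspace_kernel)
  have "dim ?W = DIM((real^'n) \<times> (real^'n)) - 1" using dim_linear_kernel[OF l(1,2)] assms(2) by simp
  then obtain a where a: "a \<noteq> 0" "span ?W = {x. a \<bullet> x = 0}"
    unfolding dim_eq_hyperplane by blast
  then have "l z = 0 \<longleftrightarrow> a \<bullet> z = 0" for z using W by (auto simp: span_eq_iff[THEN iffD2])
  \<comment> \<open>Unit normals have equal norm, as the unitary map between two hyperplanes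
    requires.\<close>
  then show thesis using a(1)
    by (intro that[of "(1 / norm a) *\<^sub>R a"]) (auto simp: L l(3))
qed

section \<open>Tangent subgroups as submanifolds\<close>

context rotational_metric
begin

lemma has_pansu_derivative_homogeneous_morphism:
  assumes "homogeneous_morphism L"
  shows "has_pansu_derivative \<rho> L p L"
proof -
  have "L q - L p - L (heis_mult (- p) q) = 0" for q
    using homogeneous_morphism_mult[OF assms, of p "heis_mult (- p) q"] by simp
  then show ?thesis using assms by (simp add: has_pansu_derivative_def)
qed

text \<open>Along the curve of dilates of \<open>p\<close> the function \<open>f\<close> is constant
  near 0, so by homogeneity the Pansu quotient is constantly \<open>norm (M p) / \<rho> 0 p\<close>,
  while it must tend to 0.\<close>

lemma pansu_derivative_vanishes:
  fixes f :: "'n heis \<Rightarrow> real^'m::finite"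
  assumes M: "has_pansu_derivative \<rho> f 0 M" and U: "open U" "0 \<in> U"
    and f: "\<And>c. 0 < c \<Longrightarrow> dil c p \<in> U \<Longrightarrow> f (dil c p) = f 0"
  shows "M p = 0"
proof (cases "p = 0")
  case True
  have "homogeneous_morphism M" using M by (simp add: has_pansu_derivative_def)
  from homogeneous_morphism_mult[OF this, of 0 0] True show ?thesis by simp
next
  case False
  have M': "homogeneous_morphism M"
    and lim: "((\<lambda>x. norm (f x - f 0 - M x) / \<rho> 0 x) \<longlongrightarrow> 0) (at 0)"
    using M by (simp_all add: has_pansu_derivative_def)
  have pos: "0 < \<rho> 0 p" using False mdist_pos_less[of 0 p] by simp
  have dil0: "((\<lambda>c. dil c p) \<longlongrightarrow> 0) (at_right 0)"
  proof -
    obtain x y t where p: "p = (x, y, t)" by (cases p) auto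
    have "((\<lambda>c. (c *\<^sub>R x, c *\<^sub>R y, c\<^sup>2 * t)) \<longlongrightarrow> (0 *\<^sub>R x, 0 *\<^sub>R y, 0\<^sup>2 * t)) (at_right 0)"
      by (intro tendsto_intros)
    then show ?thesis by (simp add: p dil_Pair zero_prod_def)
  qed
  have "dil c p \<noteq> 0" if "0 < c" for c
    using dist_0_dil[OF that, of p] pos that by auto
  then have "filterlim (\<lambda>c. dil c p) (at 0) (at_right 0)"
    using dil0 by (intro filterlim_atI) (auto simp: eventually_at_filter)
  then have "((\<lambda>c. norm (f (dil c p) - f 0 - M (dil c p)) / \<rho> 0 (dil c p)) \<longlongrightarrow> 0) (at_right 0)"
    by (rule filterlim_compose[OF lim])
  moreover have "\<forall>\<^sub>F c in at_right 0. norm (f (dil c p) - f 0 - M (dil c p)) / \<rho> 0 (dil c p) =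
      norm (M p) / \<rho> 0 p"
  proof -
    have "\<forall>\<^sub>F c in at_right 0. dil c p \<in> U" using topological_tendstoD[OF dil0 U] .
    moreover have "\<forall>\<^sub>F c in at_right (0::real). 0 < c" by (rule eventually_at_right_less)
    ultimately show ?thesis
    proof eventually_elim
      case (elim c)
      then show ?case
        using f[of c] homogeneous_morphism_dil[OF M', of c p] dist_0_dil[of c p] by simp
    qed
  qed
  ultimately have "((\<lambda>c. norm (M p) / \<rho> 0 p) \<longlongrightarrow> 0) (at_right (0::real))"
    by (rule Lim_transform_eventually)
  then have "norm (M p) / \<rho> 0 p = 0"
    using tendsto_unique[OF _ tendsto_const] trivial_limit_at_right_real by blast
  with pos show ?thesis by simp
qed

lemma tangent_subgroup_local_equation:
  fixes P :: "'n heis set" and L :: "'n heis \<Rightarrow> real^'m::finite"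
  assumes L: "homogeneous_morphism L" "surj L" "P = {p. L p = 0}" "\<exists>V. complementary P V"
  shows "local_equation \<rho> P p UNIV L"
proof -
  have D: "pansu_derivative \<rho> L = (\<lambda>_. L)"
    using pansu_derivative_eq[OF homogeneous has_pansu_derivative_homogeneous_morphism[OF L(1)]] by blast
  have "C1H \<rho> UNIV L"
    unfolding C1H_def D using has_pansu_derivative_homogeneous_morphism[OF L(1)] by (auto intro: continuous_on_const)
  moreover have "split_regular \<rho> L p"
    using L by (simp add: split_regular_def D kernel_heis)
  ultimately show ?thesis using L(3) by (simp add: local_equation_def)
qed

lemma tangent_subgroup_submanifold:
  fixes P :: "'n heis set"
  assumes P: "P \<in> tangent_subgroups TYPE('m::finite)"
  shows "C1H_submanifold TYPE('m) \<rho> P" "0 \<in> P" "horizontal_tangent TYPE('m) \<rho> P 0 = P"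
proof -
  obtain L :: "'n heis \<Rightarrow> real^'m" and l where L: "homogeneous_morphism L" "surj L" "P = {p. L p = 0}"
    "\<exists>V. complementary P V" and l: "linear l" "surj l" "\<And>p. L p = l (horizontal_part p)"
    by (rule tangent_subgroupE[OF P]) blast
  note eq = tangent_subgroup_local_equation[OF L]
  show "C1H_submanifold TYPE('m) \<rho> P" unfolding C1H_submanifold_def using eq by blast
  show 0: "0 \<in> P" using linear_0[OF l(1)] by (simp add: L(3) l(3))
  show "horizontal_tangent TYPE('m) \<rho> P 0 = P"
    unfolding horizontal_tangent_def
  proof (rule the_equality)
    have "pansu_derivative \<rho> L 0 = L"
      by (rule pansu_derivative_eq[OF homogeneous has_pansu_derivative_homogeneous_morphism[OF L(1)]])
    then show "\<exists>U (f :: 'n heis \<Rightarrow> real^'m). local_equation \<rho> P 0 U f \<and>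
        P = kernel heis_group vec_group (pansu_derivative \<rho> f 0)"
      using eq L(3) by (intro exI[of _ UNIV] exI[of _ L]) (simp add: kernel_heis)
  next
    \<comment> \<open>Any local equation at 0 is constant along the dilates of points of
      \<open>P\<close> that stay in \<open>U\<close>, so its derivative vanishes on
      \<open>P\<close>. Both kernels come from surjections of \<open>\<real>\<^sup>2\<^sup>n\<close>
      onto the same space, so equality of dimensions turns the inclusion into equality.\<close>
    fix Q assume "\<exists>U (f :: 'n heis \<Rightarrow> real^'m). local_equation \<rho> P 0 U f \<and>
        Q = kernel heis_group vec_group (pansu_derivative \<rho> f 0)"
    then obtain U and f :: "'n heis \<Rightarrow> real^'m" where f: "local_equation \<rho> P 0 U f"
      and Q: "Q = {p. pansu_derivative \<rho> f 0 p = 0}" by (auto simp: kernel_heis)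
    define M where "M = pansu_derivative \<rho> f 0"
    have U: "open U" "0 \<in> U" "P \<inter> U = {q \<in> U. f q = 0}" and surj: "surj M"
      and "\<exists>M. has_pansu_derivative \<rho> f 0 M"
      using f by (auto simp: local_equation_def C1H_def split_regular_def M_def)
    then have M: "has_pansu_derivative \<rho> f 0 M"
      unfolding M_def using pansu_derivative_eq[OF homogeneous] by metis
    then have "homogeneous_morphism M" by (simp add: has_pansu_derivative_def)
    then obtain m where m: "linear m" "\<And>p. M p = m (horizontal_part p)"
      using homogeneous_morphism_horizontal by blast
    have "surj m" using surj unfolding m(2)[abs_def] surj_def by blast
    have MP: "M p = 0" if p: "p \<in> P" for p
    proof (rule pansu_derivative_vanishes[OF M U(1,2)])
      fix c :: real assume c: "0 < c" "dil c p \<in> U"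
      have "dil c p \<in> P"
        using p homogeneous_morphism_dil[OF L(1) c(1), of p] by (simp add: L(3))
      then have "f (dil c p) = 0" using c(2) U(3) by blast
      moreover have "f 0 = 0" using U(2,3) 0 by blast
      ultimately show "f (dil c p) = f 0" by simp
    qed
    have "m z = 0" if "l z = 0" for z
    proof -
      have "lift z 0 \<in> P" using that by (simp add: L(3) l(3))
      from MP[OF this] show ?thesis by (simp add: m(2))
    qed
    then have "{z. l z = 0} \<subseteq> {z. m z = 0}" by blast
    moreover have "dim {z. l z = 0} = dim {z. m z = 0}"
      using dim_linear_kernel[OF l(1,2)] dim_linear_kernel[OF m(1) \<open>surj m\<close>] by simp
    ultimately have "{z. l z = 0} = {z. m z = 0}"
      using linear_subspace_kernel[OF l(1)] linear_subspace_kernel[OF m(1)]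
      by (intro subspace_dim_equal) simp_all
    then show "Q = P" unfolding Q M_def[symmetric] L(3) m(2) l(3) by blast
  qed
qed

end

section \<open>Constancy of the density\<close>

lemma density_eq:
  fixes \<rho> :: "'n::finite heis \<Rightarrow> 'n heis \<Rightarrow> real"
  assumes "rotational_metric \<rho>" and dens: "is_density_function TYPE('m::finite) \<rho> \<psi> \<dd>"
    and P: "P \<in> tangent_subgroups TYPE('m)" "Q \<in> tangent_subgroups TYPE('m)"
    and eq: "\<And>r. 0 < r \<Longrightarrow> \<psi> (P \<inter> Metric_space.mball UNIV \<rho> 0 r) = \<psi> (Q \<inter> Metric_space.mball UNIV \<rho> 0 r)"
  shows "\<dd> P = \<dd> Q"
proof -
  interpret rotational_metric \<rho> by fact
  define F where "F A r = \<psi> (A \<inter> mball 0 r) / ennreal (r ^ (2 * CARD('n) + 2 - CARD('m)))" for A r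
  have lim: "(F A \<longlongrightarrow> ennreal (\<dd> A)) (at_right 0)" if A: "A \<in> tangent_subgroups TYPE('m)" for A
  proof -
    note sub = tangent_subgroup_submanifold[OF A]
    have "((\<lambda>r. \<psi> (A \<inter> mball 0 r) / ennreal (r ^ (2 * CARD('n) + 2 - CARD('m))))
        \<longlongrightarrow> ennreal (\<dd> (horizontal_tangent TYPE('m) \<rho> A 0))) (at_right 0)"
      using dens sub(1,2) unfolding is_density_function_def by blast
    then show ?thesis by (simp add: sub(3) F_def[abs_def])
  qed
  have "\<forall>\<^sub>F r in at_right 0. F P r = F Q r"
    using eventually_at_right_less[of "0::real"] by eventually_elim (simp add: F_def eq)
  from Lim_transform_eventually[OF lim[OF P(1)] this]
  have "ennreal (\<dd> P) = ennreal (\<dd> Q)"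
    using lim[OF P(2)] by (rule tendsto_unique[OF trivial_limit_at_right_real])
  \<comment> \<open>\<open>ennreal\<close> sends all negative reals to 0; positivity makes it
    injective here.\<close>
  moreover have "0 < \<dd> P" "0 < \<dd> Q" using dens P by (simp_all add: is_density_function_def)
  ultimately show ?thesis by simp
qed

theorem corollary5p5:
  fixes \<rho> :: "'n::finite heis \<Rightarrow> 'n heis \<Rightarrow> real"
    and \<psi> :: "'n heis set \<Rightarrow> ennreal"
    and \<dd> :: "'n heis set \<Rightarrow> real"
  assumes "homogeneous_distance \<rho>"
    and "rotationally_invariant \<rho>"
    and "CARD('m::finite) \<le> CARD('n)"
    and "is_density_function TYPE('m) \<rho> \<psi> \<dd>"
  shows "(\<psi> = spherical_measure \<rho> (2 * CARD('n) + 2 - CARD('m)) \<longrightarrow>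
            \<dd> constant_on tangent_subgroups TYPE('m)) \<and>
         (CARD('m) = 1 \<and> \<psi> = hausdorff_measure \<rho> (2 * CARD('n) + 1) \<longrightarrow>
            \<dd> constant_on tangent_subgroups TYPE('m))"
proof -
  have rot: "rotational_metric \<rho>" using assms(1,2) by unfold_locales
  interpret rotational_metric \<rho> by (rule rot)
  have const: "\<dd> constant_on tangent_subgroups TYPE('m)"
    if eq: "\<And>P Q r. P \<in> tangent_subgroups TYPE('m) \<Longrightarrow> Q \<in> tangent_subgroups TYPE('m) \<Longrightarrow> 0 < r \<Longrightarrow>
      \<psi> (P \<inter> mball 0 r) = \<psi> (Q \<inter> mball 0 r)"
  proof -
    have "\<dd> P = \<dd> Q"
      if PQ: "P \<in> tangent_subgroups TYPE('m)" "Q \<in> tangent_subgroups TYPE('m)" for P Q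
      by (rule density_eq[OF rot assms(4) PQ]) (rule eq[OF PQ])
    then show ?thesis unfolding constant_on_def by metis
  qed
  define k where "k = 2 * CARD('n) - CARD('m)"
  \<comment> \<open>The bound on \<open>CARD('m)\<close> keeps the natural subtractions from
    truncating, and \<open>CARD('m)\<close> being positive gives the strict inequality.\<close>
  have k: "k + CARD('m) = 2 * CARD('n)" "k < 2 * CARD('n)" "2 * CARD('n) + 2 - CARD('m) = k + 2"
    using assms(3) by (simp_all add: k_def)
  show ?thesis
  proof (intro conjI impI; rule const)
    fix P Q :: "'n heis set" and r :: real
    assume PQ: "P \<in> tangent_subgroups TYPE('m)" "Q \<in> tangent_subgroups TYPE('m)" and "0 < r"
    {
      assume \<psi>: "\<psi> = spherical_measure \<rho> (2 * CARD('n) + 2 - CARD('m))"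
      obtain b where b: "frame b k" "P = frame.layer b k"
        using tangent_subgroup_layer[OF PQ(1) k(1)] by blast
      obtain b' where b': "frame b' k" "Q = frame.layer b' k"
        using tangent_subgroup_layer[OF PQ(2) k(1)] by blast
      have "metric_frame b k \<rho>" "metric_frame b' k \<rho>"
        using b(1) b'(1) rot by (simp_all add: metric_frame_def)
      from spherical_measure_layer_eq[OF this k(2) \<open>0 < r\<close>]
      show "\<psi> (P \<inter> mball 0 r) = \<psi> (Q \<inter> mball 0 r)" by (simp only: \<psi> k(3) b(2) b'(2))
    next
      assume \<psi>: "CARD('m) = 1 \<and> \<psi> = hausdorff_measure \<rho> (2 * CARD('n) + 1)"
      obtain u where u: "norm u = 1" "P = {p. u \<bullet> horizontal_part p = 0}"
        using tangent_subgroup_hyperplane[OF PQ(1)] \<psi> by blast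
      obtain v where v: "norm v = 1" "Q = {p. v \<bullet> horizontal_part p = 0}"
        using tangent_subgroup_hyperplane[OF PQ(2)] \<psi> by blast
      have uv: "norm u = norm v" using u(1) v(1) by simp
      show "\<psi> (P \<inter> mball 0 r) = \<psi> (Q \<inter> mball 0 r)"
        unfolding u(2) v(2) conjunct2[OF \<psi>]
        by (intro antisym hausdorff_measure_hyperplane_le uv uv[symmetric])
    }
  qed
qed

end
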